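(* Assume there exists a normal ideal $\mathcal{J}$ on $\omega_2$ such that $\wp(\omega_2)/\mathcal{J}$ is a proper forcing. Then $\mathrm{SCC}^{\mathrm{cof}}_{\mathrm{gap}}$ holds.
   Context: Work in ZFC. As usual a normal ideal on $\omega_2$ is proper and contains all bounded subsets of $\omega_2$, and the Boolean algebra $\wp(\omega_2)/\mathcal{J}$ is viewed as a forcing by removing its zero element. For sets $M,N$ whose intersections with $\omega_1$ are transitive, $M \sqsubseteq N$ means $M\subseteq N$ and $M\cap\omega_1=N\cap\omega_1$. $\mathrm{SCC}^{\mathrm{cof}}_{\mathrm{gap}}$ is the statement: for all sufficiently large regular $\theta$, every wellorder $\Delta$ of $H_\theta$, and every countable $N\prec(H_\theta,\in,\Delta)$, there are cofinally many $\alpha\in\omega_2$ such that there exists $N'\prec(H_\theta,\in,\Delta)$ with $N\sqsubseteq N'$, $N'\cap[\alpha,\omega_2)\neq\emptyset$, and $N'\cap[\sup(N\cap\omega_2),\alpha)=\emptyset$. *)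

theory Defs
  imports "HOL-Library.Equipollence" "HOL-Library.Countable_Set"
begin

section \<open>The universe of sets\<close>

text \<open>
  Models of ZFC whose universe is a type and whose Separation and Replacement axioms range over
  arbitrary predicates and functions of the logic. Consequently every HOL-level subset of
  \<open>elts x\<close> is itself the extension of a set, so that subsets of sets, and relations and
  functions on sets, may be given either as HOL sets or as elements of the universe. The axiom of
  Choice is not listed, because it follows from Hilbert choice and Replacement.
\<close>

class zfc =
  fixes elts :: "'a \<Rightarrow> 'a set"
  assumes zfc_extensionality: "elts x = elts y \<Longrightarrow> x = y"
    and zfc_foundation: "elts x \<noteq> {} \<Longrightarrow> \<exists>y\<in>elts x. elts y \<inter> elts x = {}"
    and zfc_pairing: "\<exists>z. elts z = {x, y}"
    and zfc_union: "\<exists>z. elts z = (\<Union>y\<in>elts x. elts y)"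
    and zfc_power_set: "\<exists>z. elts z = {y. elts y \<subseteq> elts x}"
    and zfc_infinity:
      "\<exists>z. (\<exists>e\<in>elts z. elts e = {}) \<and> (\<forall>y\<in>elts z. \<exists>s\<in>elts z. elts s = insert y (elts y))"
    and zfc_separation: "\<exists>z. elts z = {y \<in> elts x. P y}"
    and zfc_replacement: "\<exists>z. elts z = f ` elts x"

definition small :: "'v::zfc set \<Rightarrow> bool" where
  "small X \<longleftrightarrow> (\<exists>x. elts x = X)"

definition vset :: "'v::zfc set \<Rightarrow> 'v" \<comment> \<open>meaningful for small arguments only\<close> where
  "vset X = (THE x. elts x = X)"

definition opair :: "'v::zfc \<Rightarrow> 'v \<Rightarrow> 'v" where
  "opair x y = vset {vset {x}, vset {x, y}}"


section \<open>Ordinals, cardinals and \<open>H\<^sub>\<theta>\<close>\<close>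

definition transitive_set :: "'v::zfc set \<Rightarrow> bool" where
  "transitive_set X \<longleftrightarrow> (\<forall>y\<in>X. elts y \<subseteq> X)"

definition Ord :: "'v::zfc \<Rightarrow> bool" where
  "Ord \<alpha> \<longleftrightarrow> transitive_set (elts \<alpha>) \<and> (\<forall>\<beta>\<in>elts \<alpha>. transitive_set (elts \<beta>))"

definition omega0 :: "'v::zfc" where
  "omega0 = (THE \<alpha>. Ord \<alpha> \<and> infinite (elts \<alpha>) \<and> (\<forall>\<beta>\<in>elts \<alpha>. finite (elts \<beta>)))"

definition card_succ :: "'v::zfc \<Rightarrow> 'v" where
  "card_succ \<kappa> = (THE \<alpha>. Ord \<alpha> \<and> elts \<kappa> \<prec> elts \<alpha> \<and> (\<forall>\<beta>\<in>elts \<alpha>. elts \<beta> \<lesssim> elts \<kappa>))"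

definition omega1 :: "'v::zfc" where
  "omega1 = card_succ omega0"

definition omega2 :: "'v::zfc" where
  "omega2 = card_succ omega1"

definition cardinal :: "'v::zfc \<Rightarrow> bool" where
  "cardinal \<kappa> \<longleftrightarrow> Ord \<kappa> \<and> (\<forall>\<alpha>\<in>elts \<kappa>. elts \<alpha> \<prec> elts \<kappa>)"

definition regular :: "'v::zfc \<Rightarrow> bool" where
  "regular \<theta> \<longleftrightarrow> cardinal \<theta> \<and> infinite (elts \<theta>) \<and>
     (\<forall>X. X \<subseteq> elts \<theta> \<and> X \<prec> elts \<theta> \<longrightarrow> (\<exists>\<beta>\<in>elts \<theta>. X \<subseteq> elts \<beta>))"

definition for_large_regular :: "('v::zfc \<Rightarrow> bool) \<Rightarrow> bool" where
  "for_large_regular Q \<longleftrightarrow> (\<exists>\<theta>\<^sub>0. Ord \<theta>\<^sub>0 \<and> (\<forall>\<theta>. regular \<theta> \<and> \<theta>\<^sub>0 \<in> elts \<theta> \<longrightarrow> Q \<theta>))"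

text \<open>Supremum of a set of ordinals, and the ordinal interval \<open>[\<alpha>, \<beta>)\<close>.\<close>

definition ord_sup :: "'v::zfc set \<Rightarrow> 'v" where
  "ord_sup X = vset (\<Union>\<xi>\<in>X. elts \<xi>)"

definition ord_interval :: "'v::zfc \<Rightarrow> 'v \<Rightarrow> 'v set" where
  "ord_interval \<alpha> \<beta> = {\<xi> \<in> elts \<beta>. elts \<alpha> \<subseteq> elts \<xi>}"

definition trcl :: "'v::zfc \<Rightarrow> 'v set" where
  "trcl x = {y. (y, x) \<in> {(a, b). a \<in> elts b}\<^sup>+}"

definition H :: "'v::zfc \<Rightarrow> 'v set" where
  "H \<theta> = {x. trcl x \<prec> elts \<theta>}"


section \<open>Elementary substructures\<close>

text \<open>First-order formulas over a family of binary relation symbols.\<close>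

datatype 'r fm =
    Eq nat nat
  | Rel 'r nat nat
  | Neg "'r fm"
  | Conj "'r fm" "'r fm"
  | Ex nat "'r fm"

primrec sat :: "('r \<Rightarrow> 'a \<Rightarrow> 'a \<Rightarrow> bool) \<Rightarrow> 'a set \<Rightarrow> 'r fm \<Rightarrow> (nat \<Rightarrow> 'a) \<Rightarrow> bool" where
  "sat I A (Eq i j) e \<longleftrightarrow> e i = e j"
| "sat I A (Rel r i j) e \<longleftrightarrow> I r (e i) (e j)"
| "sat I A (Neg \<phi>) e \<longleftrightarrow> \<not> sat I A \<phi> e"
| "sat I A (Conj \<phi> \<psi>) e \<longleftrightarrow> sat I A \<phi> e \<and> sat I A \<psi> e"
| "sat I A (Ex i \<phi>) e \<longleftrightarrow> (\<exists>a\<in>A. sat I A \<phi> (e(i := a)))"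

definition elem_sub :: "('r \<Rightarrow> 'a \<Rightarrow> 'a \<Rightarrow> bool) \<Rightarrow> 'a set \<Rightarrow> 'a set \<Rightarrow> bool" where
  "elem_sub I N A \<longleftrightarrow> N \<noteq> {} \<and> N \<subseteq> A \<and>
     (\<forall>\<phi> e. range e \<subseteq> N \<longrightarrow> (sat I N \<phi> e \<longleftrightarrow> sat I A \<phi> e))"

definition elem_sub_H :: "'v::zfc set \<Rightarrow> 'v \<Rightarrow> bool" where
  "elem_sub_H N \<theta> \<longleftrightarrow> elem_sub (\<lambda>_::unit. \<lambda>x y. x \<in> elts y) N (H \<theta>)"

datatype mem_ord_sym = Mem_Sym | Ord_Sym

definition elem_sub_H_ord :: "'v::zfc set \<Rightarrow> 'v \<Rightarrow> ('v \<times> 'v) set \<Rightarrow> bool" where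
  "elem_sub_H_ord N \<theta> \<Delta> \<longleftrightarrow>
     elem_sub (\<lambda>r x y. case r of Mem_Sym \<Rightarrow> x \<in> elts y | Ord_Sym \<Rightarrow> (x, y) \<in> \<Delta>) N (H \<theta>)"


section \<open>Proper forcing\<close>

text \<open>
  A forcing is a nonempty preorder \<open>(P, R)\<close> whose carrier is a set of the universe;
  \<open>(p, q) \<in> R\<close> means that \<open>p\<close> is at least as strong as \<open>q\<close>.
\<close>

definition forcing :: "'v::zfc set \<Rightarrow> ('v \<times> 'v) set \<Rightarrow> bool" where
  "forcing P R \<longleftrightarrow> small P \<and> P \<noteq> {} \<and> preorder_on P R"

definition forcing_code :: "'v::zfc set \<Rightarrow> ('v \<times> 'v) set \<Rightarrow> 'v" where
  "forcing_code P R = opair (vset P) (vset ((\<lambda>(p, q). opair p q) ` R))"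

definition dense_in :: "'v::zfc set \<Rightarrow> ('v \<times> 'v) set \<Rightarrow> 'v set \<Rightarrow> bool" where
  "dense_in P R D \<longleftrightarrow> D \<subseteq> P \<and> (\<forall>p\<in>P. \<exists>d\<in>D. (d, p) \<in> R)"

definition predense_below :: "'v::zfc set \<Rightarrow> ('v \<times> 'v) set \<Rightarrow> 'v set \<Rightarrow> 'v \<Rightarrow> bool" where
  "predense_below P R D q \<longleftrightarrow>
     (\<forall>r\<in>P. (r, q) \<in> R \<longrightarrow> (\<exists>d\<in>D. \<exists>s\<in>P. (s, r) \<in> R \<and> (s, d) \<in> R))"

definition generic_condition ::
    "'v::zfc set \<Rightarrow> ('v \<times> 'v) set \<Rightarrow> 'v set \<Rightarrow> 'v \<Rightarrow> bool" where
  "generic_condition P R M q \<longleftrightarrow> q \<in> P \<and>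
     (\<forall>D\<in>M. dense_in P R (elts D) \<longrightarrow> predense_below P R (elts D \<inter> M) q)"

definition proper_forcing :: "'v::zfc set \<Rightarrow> ('v \<times> 'v) set \<Rightarrow> bool" where
  "proper_forcing P R \<longleftrightarrow> forcing P R \<and>
     for_large_regular (\<lambda>\<chi>. \<forall>M. countable M \<and> elem_sub_H M \<chi> \<and> forcing_code P R \<in> M \<longrightarrow>
       (\<forall>p \<in> P \<inter> M. \<exists>q. (q, p) \<in> R \<and> generic_condition P R M q))"


section \<open>Normal ideals and their quotients\<close>

definition ideal_on :: "'v::zfc \<Rightarrow> 'v set set \<Rightarrow> bool" where
  "ideal_on \<kappa> J \<longleftrightarrow> J \<subseteq> Pow (elts \<kappa>) \<and> {} \<in> J \<and>
     (\<forall>X\<in>J. \<forall>Y. Y \<subseteq> X \<longrightarrow> Y \<in> J) \<and> (\<forall>X\<in>J. \<forall>Y\<in>J. X \<union> Y \<in> J)"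

text \<open>Proper ideals containing the bounded sets and closed under diagonal unions.\<close>

definition normal_ideal_on :: "'v::zfc \<Rightarrow> 'v set set \<Rightarrow> bool" where
  "normal_ideal_on \<kappa> J \<longleftrightarrow> ideal_on \<kappa> J \<and> elts \<kappa> \<notin> J \<and>
     (\<forall>X \<beta>. \<beta> \<in> elts \<kappa> \<and> X \<subseteq> elts \<beta> \<longrightarrow> X \<in> J) \<and>
     (\<forall>X. (\<forall>\<xi>\<in>elts \<kappa>. X \<xi> \<in> J) \<longrightarrow> {\<alpha> \<in> elts \<kappa>. \<exists>\<xi>\<in>elts \<alpha>. \<alpha> \<in> X \<xi>} \<in> J)"

text \<open>The class of \<open>X\<close> in \<open>\<wp>(\<kappa>)/J\<close>, as an element of the universe.\<close>

definition quot_class :: "'v::zfc \<Rightarrow> 'v set set \<Rightarrow> 'v set \<Rightarrow> 'v" where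
  "quot_class \<kappa> J X = vset (vset ` {Y. Y \<subseteq> elts \<kappa> \<and> sym_diff X Y \<in> J})"

definition quot_carrier :: "'v::zfc \<Rightarrow> 'v set set \<Rightarrow> 'v set" where
  "quot_carrier \<kappa> J = quot_class \<kappa> J ` Pow (elts \<kappa>) - {quot_class \<kappa> J {}}"

definition quot_le :: "'v::zfc \<Rightarrow> 'v set set \<Rightarrow> ('v \<times> 'v) set" where
  "quot_le \<kappa> J = {(p, q) \<in> quot_carrier \<kappa> J \<times> quot_carrier \<kappa> J.
     \<exists>X Y. X \<subseteq> elts \<kappa> \<and> Y \<subseteq> elts \<kappa> \<and>
       p = quot_class \<kappa> J X \<and> q = quot_class \<kappa> J Y \<and> X - Y \<in> J}"


section \<open>The gap version of Strong Chang's Conjecture\<close>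

text \<open>
  Only used for sets whose intersections with \<open>\<omega>\<^sub>1\<close> are transitive; this is automatic for
  elementary substructures of \<open>H\<^sub>\<theta>\<close>, \<open>\<theta> > \<omega>\<^sub>1\<close>, that are countable or have the same
  intersection with \<open>\<omega>\<^sub>1\<close> as a countable one.
\<close>

definition end_sub :: "'v::zfc set \<Rightarrow> 'v set \<Rightarrow> bool" (infix \<open>\<sqsubseteq>\<close> 50) where
  "M \<sqsubseteq> N \<longleftrightarrow> M \<subseteq> N \<and> M \<inter> elts omega1 = N \<inter> elts omega1"

text \<open>The type argument selects the universe in which the statement is interpreted.\<close>

definition SCC_cof_gap :: "'v::zfc itself \<Rightarrow> bool" where
  "SCC_cof_gap _ \<longleftrightarrow>
     for_large_regular (\<lambda>\<theta>::'v. \<forall>\<Delta> N.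
       well_order_on (H \<theta>) \<Delta> \<and> countable N \<and> elem_sub_H_ord N \<theta> \<Delta> \<longrightarrow>
       (\<forall>\<beta>\<in>elts omega2. \<exists>\<alpha>\<in>elts omega2. elts \<beta> \<subseteq> elts \<alpha> \<and>
         (\<exists>N'. elem_sub_H_ord N' \<theta> \<Delta> \<and> N \<sqsubseteq> N' \<and>
           N' \<inter> ord_interval \<alpha> omega2 \<noteq> {} \<and>
           N' \<inter> ord_interval (ord_sup (N \<inter> elts omega2)) \<alpha> = {})))"

end

(*
  Let J be the ideal, P the quotient forcing, and M a countable elementary submodel containing P.
  For a regressive partial function f in M the classes of the positive sets on which f is either
  constant or undefined are dense in P, by normality. If the class of Q is M-generic, then by
  predensity almost every a in Q satisfies: if f(a) is defined, it is the constant value of f on a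
  set whose class lies in M, so f(a) is in M. As J is countably complete, unboundedly many a
  satisfy this for all regressive f in M simultaneously. For such an a the set N' of all values
  f(a), f in N, is elementary by means of Delta-least witnesses, and N' and N have the same
  elements below a.

  This requires a suitable N in place of M, although N need not contain J. Skolem functions of
  some H(chi) together with the maps f |-> dense set and (f, condition) |-> constant value are
  therefore coded by one set c such that every countable set closed under c and pairing has the
  above property. The existence of such a c is first-order over H(theta) with parameters omega and
  omega2, both definable, so some such c lies in N, and N is closed under it.
*)

theory Submission
  imports Defs
begin

text \<open>The order \<Delta> is arbitrary, so nothing ties N to J or to the models for which
  properness provides generic conditions; all information about J has to pass through the single set
  c. Its defining property is expressible over H(theta) because every countable subset of H(theta)
  is an element of H(theta), so that a quantifier over countable sets closed under c is first-order
  there. Regressive functions have to be partial because a function f in N need not satisfy f(a) <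
  a. If a value x = f(a) does lie below a, then the part of f below the diagonal is a regressive
  function in N with the value x at a, so x is in N. The gap follows: a is in N' through the
  identity function, and an element of N' below a is in N, hence strictly below sup(N \<inter>
  omega_2), as N \<inter> omega_2 has no largest element. Taking a above omega_1 also gives N
  \<sqsubseteq> N'.\<close>

section \<open>Small sets and the membership relation\<close>

lemma elts_inject [simp]: "elts x = elts y \<longleftrightarrow> x = y" for x :: "'v::zfc"
  using zfc_extensionality by blast

lemma small_elts [simp]: "small (elts x)"
  unfolding small_def by blast

lemma elts_vset [simp]: "small X \<Longrightarrow> elts (vset X) = X"
proof -
  assume "small X"
  then obtain x where "elts x = X"
    unfolding small_def by blast
  then show ?thesis
    unfolding vset_def by (rule theI) (use \<open>elts x = X\<close> elts_inject in blast)
qed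

lemma vset_elts [simp]: "vset (elts x) = x"
  by (simp add: vset_def)

lemma small_subset: "small X \<Longrightarrow> Y \<subseteq> X \<Longrightarrow> small Y"
proof -
  assume "small X" "Y \<subseteq> X"
  then obtain x where "elts x = X"
    unfolding small_def by blast
  moreover obtain z where "elts z = {y \<in> elts x. y \<in> Y}"
    using zfc_separation[of x "\<lambda>y. y \<in> Y"] by blast
  ultimately have "elts z = Y"
    using \<open>Y \<subseteq> X\<close> by blast
  then show ?thesis
    unfolding small_def by blast
qed

lemma small_image: "small X \<Longrightarrow> small (f ` X)" for f :: "'v::zfc \<Rightarrow> 'v"
proof -
  assume "small X"
  then obtain x where "elts x = X"
    unfolding small_def by blast
  then show ?thesis
    using zfc_replacement[of f x] unfolding small_def by simp
qed

lemma small_Union: "small X \<Longrightarrow> (\<And>x. x \<in> X \<Longrightarrow> small (F x)) \<Longrightarrow> small (\<Union>x\<in>X. F x)"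
  for F :: "'v::zfc \<Rightarrow> 'v set"
proof -
  assume X: "small X" and F: "\<And>x. x \<in> X \<Longrightarrow> small (F x)"
  obtain z where z: "elts z = (\<lambda>x. vset (F x)) ` X"
    using small_image[OF X, of "\<lambda>x. vset (F x)"] unfolding small_def by blast
  obtain w where "elts w = (\<Union>y\<in>elts z. elts y)"
    using zfc_union by blast
  then have "elts w = (\<Union>x\<in>X. F x)"
    using z F by auto
  then show ?thesis
    unfolding small_def by blast
qed

lemma small_doubleton: "small {x, y}"
  unfolding small_def using zfc_pairing by blast

lemma small_singleton: "small {x}"
  using small_doubleton[of x x] by simp

lemma small_Un: "small X \<Longrightarrow> small Y \<Longrightarrow> small (X \<union> Y)"
proof -
  assume "small X" "small Y"
  then have "small (\<Union>z\<in>{vset X, vset Y}. elts z)"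
    by (intro small_Union small_doubleton) auto
  then show ?thesis
    using \<open>small X\<close> \<open>small Y\<close> by simp
qed

lemma small_insert: "small X \<Longrightarrow> small (insert x X)"
  using small_Un[OF small_singleton, of X x] by simp

lemma small_vset_Pow: "small (vset ` Pow (elts x))"
proof -
  obtain z where "elts z = {y. elts y \<subseteq> elts x}"
    using zfc_power_set by blast
  moreover have "{y. elts y \<subseteq> elts x} = vset ` Pow (elts x)"
  proof
    show "{y. elts y \<subseteq> elts x} \<subseteq> vset ` Pow (elts x)"
      by (auto intro: image_eqI[where f = vset, OF vset_elts[symmetric]])
    show "vset ` Pow (elts x) \<subseteq> {y. elts y \<subseteq> elts x}"
    proof
      fix y assume "y \<in> vset ` Pow (elts x)"
      then obtain Y where "y = vset Y" "Y \<subseteq> elts x"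
        by blast
      then show "y \<in> {y. elts y \<subseteq> elts x}"
        using elts_vset[OF small_subset[OF small_elts[of x], of Y]] by simp
    qed
  qed
  ultimately show ?thesis
    unfolding small_def by blast
qed

lemma mem_not_refl: "x \<notin> elts x"
  using zfc_foundation[of "vset {x}"] by (auto simp: small_singleton)

text \<open>Iterated successors of an element of an inductive set contain all earlier ones, so
  membership tells them apart. The range serves as a copy of nat inside the universe.\<close>

lemma infinite_small_nat: "\<exists>h :: nat \<Rightarrow> 'v::zfc. inj h \<and> small (range h)"
proof -
  obtain z e :: 'v where e: "e \<in> elts z" and
    s: "\<forall>y\<in>elts z. \<exists>s\<in>elts z. elts s = insert y (elts y)"
    using zfc_infinity by blast
  obtain g where g: "\<And>y. y \<in> elts z \<Longrightarrow> g y \<in> elts z \<and> elts (g y) = insert y (elts y)"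
    using s by metis
  define h where "h n = (g ^^ n) e" for n
  have h: "h n \<in> elts z" for n
    by (induction n) (auto simp: h_def e g)
  have hS: "elts (h (Suc n)) = insert (h n) (elts (h n))" for n
    using g[OF h] by (simp add: h_def)
  have lt: "m < n \<Longrightarrow> h m \<in> elts (h n)" for m n
    by (induction n) (auto simp: hS less_Suc_eq)
  have "inj h"
    by (rule injI) (metis lt mem_not_refl linorder_neqE_nat)
  moreover have "small (range h)"
    using small_subset[OF small_elts[of z], of "range h"] h by blast
  ultimately show ?thesis
    by blast
qed

lemma small_lepoll:
  fixes A B :: "'v::zfc set"
  assumes "A \<lesssim> B" and "small B"
  shows "small A"
  using assms small_image small_subset unfolding lepoll_iff by blast

text \<open>Replacement speaks of functions between elements of the universe, so an enumeration by
  nat is first pulled back to the small copy of nat.\<close>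

lemma countable_small: "countable A \<Longrightarrow> small A" for A :: "'v::zfc set"
proof -
  assume "countable A"
  obtain h :: "nat \<Rightarrow> 'v" where "inj h" and "small (range h)"
    using infinite_small_nat by blast
  moreover have "A = (from_nat_into A \<circ> inv h) ` range h" if "A \<noteq> {}"
    using range_from_nat_into[OF that \<open>countable A\<close>] \<open>inj h\<close> by (simp add: image_image)
  ultimately show ?thesis
    by (metis small_image small_subset empty_subsetI)
qed

lemma small_UN_nat: "(\<And>n::nat. small (F n)) \<Longrightarrow> small (\<Union>n. F n :: 'v::zfc set)"
proof -
  assume F: "\<And>n. small (F n)"
  have "small (\<Union>x\<in>range (\<lambda>n. vset (F n)). elts x)"
    by (rule small_Union[OF countable_small]) auto
  then show ?thesis
    using F by simp
qed

section \<open>Transitive closures, well-foundedness of membership, ordered pairs\<close>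

lemma trcl_unfold: "trcl x = elts x \<union> (\<Union>y\<in>elts x. trcl y)"
proof -
  have "(y, x) \<in> {(a, b). a \<in> elts b}\<^sup>+ \<longleftrightarrow>
      y \<in> elts x \<or> (\<exists>z\<in>elts x. (y, z) \<in> {(a, b). a \<in> elts b}\<^sup>+)" for y
    by (subst trancl_unfold_right) (auto simp: rtrancl_eq_or_trancl)
  then show ?thesis
    by (auto simp: trcl_def)
qed

lemma elts_subset_trcl: "elts x \<subseteq> trcl x"
  using trcl_unfold by blast

lemma trcl_mono_mem: "y \<in> elts x \<Longrightarrow> trcl y \<subseteq> trcl x"
  using trcl_unfold by blast

lemma trcl_trans: "y \<in> trcl x \<Longrightarrow> elts y \<subseteq> trcl x"
  unfolding trcl_def by (auto intro: trancl_into_trancl2)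

lemma trcl_least:
  assumes "elts x \<subseteq> T" "\<And>y. y \<in> T \<Longrightarrow> elts y \<subseteq> T"
  shows "trcl x \<subseteq> T"
proof
  fix y assume "y \<in> trcl x"
  then have "(y, x) \<in> {(a, b). a \<in> elts b}\<^sup>+"
    by (simp add: trcl_def)
  then show "y \<in> T"
    by (induction rule: converse_trancl_induct) (use assms in auto)
qed

lemma small_trcl: "small (trcl x)"
proof -
  define T where "T = rec_nat (elts x) (\<lambda>_ X. \<Union>y\<in>X. elts y)"
  have "small (T n)" for n
    by (induction n) (auto simp: T_def intro: small_Union)
  then have "small (\<Union>n. T n)"
    by (rule small_UN_nat)
  moreover have "trcl x \<subseteq> (\<Union>n. T n)"
  proof (rule trcl_least)
    show "elts x \<subseteq> (\<Union>n. T n)"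
      using UN_upper[of 0 UNIV T] by (simp add: T_def)
    fix y assume "y \<in> (\<Union>n. T n)"
    then obtain n where "y \<in> T n"
      by blast
    then have "elts y \<subseteq> T (Suc n)"
      by (auto simp: T_def)
    then show "elts y \<subseteq> (\<Union>n. T n)"
      by blast
  qed
  ultimately show ?thesis
    by (rule small_subset)
qed

text \<open>The axiom of foundation concerns sets, whereas Q may be a proper class. It is applied to
  the part of Q in x and its transitive closure, which contains every element of Q that lies in a
  member of that part.\<close>

lemma wf_mem: "wf {(a, b). a \<in> elts b}"
proof (rule wfI_min)
  fix x :: 'a and Q assume "x \<in> Q"
  have sm: "small (Q \<inter> insert x (trcl x))"
    by (rule small_subset[OF small_insert[OF small_trcl]]) blast
  then obtain y where y: "y \<in> Q" "y \<in> insert x (trcl x)" "elts y \<inter> (Q \<inter> insert x (trcl x)) = {}"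
    using zfc_foundation[of "vset (Q \<inter> insert x (trcl x))"] \<open>x \<in> Q\<close> by auto
  moreover have "elts y \<subseteq> trcl x"
    using y(2) elts_subset_trcl trcl_trans by blast
  ultimately show "\<exists>z\<in>Q. \<forall>y. (y, z) \<in> {(a, b). a \<in> elts b} \<longrightarrow> y \<notin> Q"
    by (intro bexI[of _ y]) auto
qed

lemma elts_opair: "elts (opair x y) = {vset {x}, vset {x, y}}"
  by (simp add: opair_def small_doubleton)

lemma vset_doubleton_eq: "vset {x, y} = vset {a, b} \<longleftrightarrow> {x, y} = {a, b}"
  by (metis elts_vset small_doubleton)

lemma opair_inject [simp]: "opair x y = opair a b \<longleftrightarrow> x = a \<and> y = b"
proof
  assume "opair x y = opair a b"
  \<comment> \<open>Writing singletons as doubletons lets one rule decide all the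
    equalities.\<close>
  then have "{vset {x, x}, vset {x, y}} = {vset {a, a}, vset {a, b}}"
    by (metis elts_opair insert_absorb2)
  then show "x = a \<and> y = b"
    by (auto simp: doubleton_eq_iff vset_doubleton_eq simp del: insert_absorb2)
qed simp

section \<open>Ordinals and cardinals\<close>

lemma Ord_mem: "Ord \<alpha> \<Longrightarrow> \<beta> \<in> elts \<alpha> \<Longrightarrow> Ord \<beta>"
  unfolding Ord_def transitive_set_def by blast

lemma Ord_trans: "Ord \<alpha> \<Longrightarrow> \<beta> \<in> elts \<alpha> \<Longrightarrow> elts \<beta> \<subseteq> elts \<alpha>"
  unfolding Ord_def transitive_set_def by blast

text \<open>Double induction on membership: if \<alpha> and \<beta> were incomparable, the induction
  hypotheses and transitivity would put every element of either one into the other, and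
  extensionality would make them equal.\<close>

lemma Ord_linear: "Ord \<alpha> \<Longrightarrow> Ord \<beta> \<Longrightarrow> \<alpha> \<in> elts \<beta> \<or> \<alpha> = \<beta> \<or> \<beta> \<in> elts \<alpha>"
proof (induction \<alpha> arbitrary: \<beta> rule: wf_induct_rule[OF wf_mem])
  case (1 \<alpha>)
  note IH\<alpha> = 1
  from IH\<alpha>(3) show ?case
  proof (induction \<beta> rule: wf_induct_rule[OF wf_mem])
    case (1 \<beta>)
    show ?case
    proof (rule ccontr)
      assume neg: "\<not> (\<alpha> \<in> elts \<beta> \<or> \<alpha> = \<beta> \<or> \<beta> \<in> elts \<alpha>)"
      have "elts \<alpha> \<subseteq> elts \<beta>"
      proof
        fix \<xi> assume "\<xi> \<in> elts \<alpha>"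
        then show "\<xi> \<in> elts \<beta>"
          using IH\<alpha>(1)[of \<xi> \<beta>] neg "1.prems" IH\<alpha>(2) Ord_mem Ord_trans by blast
      qed
      moreover have "elts \<beta> \<subseteq> elts \<alpha>"
      proof
        fix \<xi> assume "\<xi> \<in> elts \<beta>"
        then show "\<xi> \<in> elts \<alpha>"
          using "1.IH"[of \<xi>] neg "1.prems" Ord_mem Ord_trans by blast
      qed
      ultimately show False
        using neg by (metis elts_inject subset_antisym)
    qed
  qed
qed

lemma Ord_least:
  assumes "Ord \<alpha>" "P \<alpha>"
  shows "\<exists>\<beta>. Ord \<beta> \<and> P \<beta> \<and> (\<forall>\<gamma>\<in>elts \<beta>. \<not> P \<gamma>)"
proof -
  have "\<alpha> \<in> {\<beta>. Ord \<beta> \<and> P \<beta>}"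
    using assms by simp
  then obtain \<beta> where "\<beta> \<in> {\<beta>. Ord \<beta> \<and> P \<beta>}" "\<And>\<gamma>. \<gamma> \<in> elts \<beta> \<Longrightarrow> \<gamma> \<notin> {\<beta>. Ord \<beta> \<and> P \<beta>}"
    by (rule wfE_min[OF wf_mem]) auto
  then show ?thesis
    using Ord_mem by blast
qed

lemma Ord_succ: "Ord \<alpha> \<Longrightarrow> Ord (vset (insert \<alpha> (elts \<alpha>)))"
  by (auto simp: Ord_def transitive_set_def small_insert)

text \<open>The collapse f a = {f b | b < a} along a wellorder of X is injective, and its image is
  an ordinal.\<close>

lemma Ord_of_eqpoll:
  fixes X :: "'v::zfc set"
  assumes "small X"
  shows "\<exists>\<alpha> :: 'v. Ord \<alpha> \<and> elts \<alpha> \<approx> X"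
proof -
  obtain r where r: "well_order_on X r"
    using well_order_on by blast
  then have wf: "wf (r - Id)" and lin: "total_on X r" and rX: "r \<subseteq> X \<times> X"
    and tr: "trans r" and as: "antisym r"
    unfolding well_order_on_def linear_order_on_def partial_order_on_def preorder_on_def
      refl_on_def by auto
  have trs: "trans (r - Id)"
    using tr as by (auto simp: trans_def antisym_def)
  define f :: "'v \<Rightarrow> 'v" where "f = wfrec (r - Id) (\<lambda>f a. vset (f ` {b. (b, a) \<in> r - Id}))"
  have sm: "small (f ` {b. (b, a) \<in> r - Id})" for a
    by (rule small_image[OF small_subset[OF assms]]) (use rX in auto)
  have f: "elts (f a) = f ` {b. (b, a) \<in> r - Id}" for a
  proof -
    have "f a = vset (cut f (r - Id) a ` {b. (b, a) \<in> r - Id})"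
      unfolding f_def by (rule wfrec[OF wf])
    also have "cut f (r - Id) a ` {b. (b, a) \<in> r - Id} = f ` {b. (b, a) \<in> r - Id}"
      by (rule image_cong) (auto simp: cut_def)
    finally show ?thesis
      using elts_vset[OF sm[of a]] by argo
  qed
  have fX: "elts (vset (f ` X)) = f ` X"
    by (simp add: small_image assms)
  have tf: "transitive_set (elts (f a))" for a
    unfolding transitive_set_def
  proof (intro ballI subsetI)
    fix z y assume "z \<in> elts (f a)" "y \<in> elts z"
    then obtain b where b: "(b, a) \<in> r - Id" "y \<in> elts (f b)"
      unfolding f[of a] by blast
    then obtain c where "y = f c" "(c, b) \<in> r - Id"
      unfolding f[of b] by blast
    then show "y \<in> elts (f a)"
      using transD[OF trs _ b(1), of c] unfolding f[of a] by blast
  qed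
  have "transitive_set (f ` X)"
    unfolding transitive_set_def
  proof safe
    fix b y assume "y \<in> elts (f b)"
    then show "y \<in> f ` X"
      unfolding f[of b] using rX by blast
  qed
  then have "Ord (vset (f ` X))"
    unfolding Ord_def fX using tf by blast
  moreover have "inj_on f X"
  proof (rule inj_onI)
    fix a b assume "a \<in> X" "b \<in> X" "f a = f b"
    moreover have "f a \<in> elts (f b)" if "(a, b) \<in> r - Id" for a b
      unfolding f[of b] using that by blast
    ultimately show "a = b"
      using lin mem_not_refl unfolding total_on_def by (metis DiffI pair_in_Id_conv)
  qed
  ultimately show ?thesis
    by (metis fX inj_on_image_eqpoll_self)
qed

section \<open>Cardinalities and the ordinals omega, omega_1, omega_2\<close>

lemma lepoll_total: "A \<lesssim> B \<or> B \<lesssim> A"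
  unfolding lepoll_def by (metis card_of_ordLeq ordLeq_total card_of_Well_order)

lemma not_lepoll_iff_lesspoll: "\<not> A \<lesssim> B \<longleftrightarrow> B \<prec> A"
  by (metis lepoll_total lepoll_antisym lesspoll_def eqpoll_imp_lepoll eqpoll_sym)

lemma lepoll_iff_card_of: "A \<lesssim> B \<longleftrightarrow> (card_of A, card_of B) \<in> ordLeq"
  unfolding lepoll_def card_of_ordLeq[symmetric] by blast

lemma infinite_UN_lepoll:
  assumes "infinite B" "I \<lesssim> B" "\<And>i. i \<in> I \<Longrightarrow> A i \<lesssim> B"
  shows "(\<Union>i\<in>I. A i) \<lesssim> B"
  using card_of_UNION_ordLeq_infinite assms unfolding lepoll_iff_card_of by blast

lemma omega0_spec:
  "Ord (omega0 :: 'v::zfc)" "infinite (elts (omega0 :: 'v))"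
  "\<beta> \<in> elts (omega0 :: 'v) \<Longrightarrow> finite (elts \<beta>)"
proof -
  let ?P = "\<lambda>\<alpha> :: 'v. Ord \<alpha> \<and> infinite (elts \<alpha>) \<and> (\<forall>\<beta>\<in>elts \<alpha>. finite (elts \<beta>))"
  obtain h :: "nat \<Rightarrow> 'v" where "inj h" "small (range h)"
    using infinite_small_nat by blast
  then obtain \<alpha> :: 'v where "Ord \<alpha>" "infinite (elts \<alpha>)"
    using Ord_of_eqpoll[of "range h"] eqpoll_finite_iff range_inj_infinite by blast
  then obtain \<delta> where "?P \<delta>"
    using Ord_least[of \<alpha> "\<lambda>\<alpha>. infinite (elts \<alpha>)"] by blast
  moreover from this have "\<gamma> = \<delta>" if "?P \<gamma>" for \<gamma>
    using Ord_linear[of \<delta> \<gamma>] that by blast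
  ultimately have "?P omega0"
    unfolding omega0_def by (rule theI)
  then show "Ord (omega0 :: 'v)" "infinite (elts (omega0 :: 'v))"
    "\<beta> \<in> elts (omega0 :: 'v) \<Longrightarrow> finite (elts \<beta>)"
    by auto
qed

text \<open>By Cantor's theorem an ordinal equipollent with the power set of \<kappa> is large
  enough; the least large enough ordinal is the one sought, and linearity of the ordinals makes it
  unique.\<close>

lemma card_succ_unique:
  fixes \<kappa> :: "'v::zfc"
  shows "\<exists>!\<alpha> :: 'v. Ord \<alpha> \<and> elts \<kappa> \<prec> elts \<alpha> \<and> (\<forall>\<beta>\<in>elts \<alpha>. elts \<beta> \<lesssim> elts \<kappa>)"
proof -
  let ?P = "\<lambda>\<alpha>. Ord \<alpha> \<and> elts \<kappa> \<prec> elts \<alpha> \<and> (\<forall>\<beta>\<in>elts \<alpha>. elts \<beta> \<lesssim> elts \<kappa>)"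
  obtain \<alpha> :: 'v where \<alpha>: "Ord \<alpha>" "elts \<alpha> \<approx> vset ` Pow (elts \<kappa>)"
    using Ord_of_eqpoll[OF small_vset_Pow] by blast
  have "inj_on vset (Pow (elts \<kappa>))"
    by (rule inj_onI) (metis PowD elts_vset small_elts small_subset)
  then have "elts \<alpha> \<approx> Pow (elts \<kappa>)"
    using \<alpha>(2) by simp
  then have "elts \<kappa> \<prec> elts \<alpha>"
    using lesspoll_Pow_self lesspoll_eq_trans eqpoll_sym by blast
  then obtain \<beta> :: 'v where \<beta>: "Ord \<beta>" "elts \<kappa> \<prec> elts \<beta>" "\<forall>\<gamma>\<in>elts \<beta>. \<not> elts \<kappa> \<prec> elts \<gamma>"
    using Ord_least[OF \<alpha>(1), of "\<lambda>\<alpha>. elts \<kappa> \<prec> elts \<alpha>"] by metis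
  then have "?P \<beta>"
    using not_lepoll_iff_lesspoll by blast
  moreover have "\<gamma> = \<beta>" if "?P \<gamma>" for \<gamma>
    using Ord_linear[OF \<beta>(1), of \<gamma>] that \<open>?P \<beta>\<close> not_lepoll_iff_lesspoll by metis
  ultimately show ?thesis
    by blast
qed

lemma card_succ_spec:
  "Ord (card_succ \<kappa>)" "elts \<kappa> \<prec> elts (card_succ \<kappa>)"
  "\<beta> \<in> elts (card_succ \<kappa>) \<Longrightarrow> elts \<beta> \<lesssim> elts \<kappa>"
  using theI'[OF card_succ_unique[of \<kappa>]] unfolding card_succ_def by blast+

text \<open>Phrased with \<open>\<lesssim>\<close> and its negation because this is the relation
  that \<open>fm_lepoll\<close> expresses.\<close>

lemma card_succ_eqI:
  "Ord \<alpha> \<Longrightarrow> \<not> elts \<alpha> \<lesssim> elts \<kappa> \<Longrightarrow> (\<And>\<beta>. \<beta> \<in> elts \<alpha> \<Longrightarrow> elts \<beta> \<lesssim> elts \<kappa>) \<Longrightarrow> \<alpha> = card_succ \<kappa>"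
  unfolding not_lepoll_iff_lesspoll
  unfolding card_succ_def
  by (rule the1_equality[OF card_succ_unique, symmetric]) blast

lemma mem_card_succ: "Ord \<kappa> \<Longrightarrow> \<kappa> \<in> elts (card_succ \<kappa>)"
  using Ord_linear[of \<kappa> "card_succ \<kappa>"] card_succ_spec[of \<kappa>]
  by (metis Ord_trans lesspoll_not_refl not_lepoll_iff_lesspoll subset_imp_lepoll)

text \<open>One more point does not raise an infinite cardinality, and finite sets stay below
  \<kappa>; hence the ordinal successor of \<beta> is still below the cardinal successor of
  \<kappa>.\<close>

lemma card_succ_limit:
  assumes "infinite (elts \<kappa>)" "\<beta> \<in> elts (card_succ \<kappa>)"
  shows "\<exists>\<gamma>\<in>elts (card_succ \<kappa>). \<beta> \<in> elts \<gamma>"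
proof -
  let ?s = "vset (insert \<beta> (elts \<beta>))"
  have s: "elts ?s = insert \<beta> (elts \<beta>)" "Ord ?s"
    using Ord_succ Ord_mem card_succ_spec(1) assms(2) by (auto simp: small_insert)
  have "elts ?s \<lesssim> elts \<kappa>"
  proof (cases "finite (elts \<beta>)")
    case True
    then show ?thesis
      by (intro finite_lepoll_infinite) (simp_all add: assms(1) s)
  next
    case False
    then show ?thesis
      using infinite_insert_eqpoll card_succ_spec(3)[OF assms(2)] lepoll_trans1 s by metis
  qed
  then have "?s \<in> elts (card_succ \<kappa>)"
    using Ord_linear[OF s(2) card_succ_spec(1)] card_succ_spec(2)[of \<kappa>]
    by (metis Ord_trans s(2) lepoll_trans not_lepoll_iff_lesspoll subset_imp_lepoll)
  then show ?thesis
    using s(1) by blast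
qed

lemma omega_facts:
  "Ord (omega1 :: 'v::zfc)" "Ord (omega2 :: 'v)"
  "(omega0 :: 'v) \<in> elts omega1" "(omega1 :: 'v) \<in> elts omega2" "(omega0 :: 'v) \<in> elts omega2"
proof -
  show 1: "Ord (omega1 :: 'v)" "Ord (omega2 :: 'v)"
    by (simp_all add: omega1_def omega2_def card_succ_spec)
  show 2: "(omega0 :: 'v) \<in> elts omega1" "(omega1 :: 'v) \<in> elts omega2"
    using mem_card_succ omega0_spec(1) 1 by (auto simp: omega1_def omega2_def)
  show "(omega0 :: 'v) \<in> elts omega2"
    using 1 2 Ord_trans by blast
qed

text \<open>Turns countability, a notion of the logic, into a relation between sets that a formula
  over \<open>H \<theta>\<close> can express.\<close>

lemma countable_lepoll_omega0: "countable A \<longleftrightarrow> A \<lesssim> elts (omega0 :: 'v::zfc)"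
proof -
  have c: "countable (elts (omega0 :: 'v))"
  proof -
    \<comment> \<open>A countably infinite subset of omega is equipollent with an infinite ordinal,
      and every infinite ordinal includes omega.\<close>
    obtain f :: "nat \<Rightarrow> 'v" where f: "inj f" "range f \<subseteq> elts omega0"
      using infinite_countable_subset[OF omega0_spec(2)] by blast
    obtain \<alpha> :: 'v where \<alpha>: "Ord \<alpha>" "elts \<alpha> \<approx> range f"
      using Ord_of_eqpoll[OF small_subset[OF small_elts f(2)]] by auto
    have "infinite (elts \<alpha>)"
      using eqpoll_finite_iff[OF \<alpha>(2)] range_inj_infinite[OF f(1)] by simp
    then have "elts omega0 \<subseteq> elts \<alpha>"
      using Ord_linear[OF \<alpha>(1) omega0_spec(1)] omega0_spec(3) Ord_trans[OF \<alpha>(1)] by auto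
    moreover have "countable (elts \<alpha>)"
      using countable_eqpoll[OF _ \<alpha>(2)] by simp
    ultimately show ?thesis
      by (rule countable_subset)
  qed
  show ?thesis
  proof
    assume "countable A"
    then have "A \<lesssim> (UNIV :: nat set)"
      unfolding countable_def lepoll_def by blast
    also have "\<dots> \<lesssim> elts (omega0 :: 'v)"
      using omega0_spec(2) infinite_le_lepoll by blast
    finally show "A \<lesssim> elts (omega0 :: 'v)" .
  qed (use c countable_lepoll in blast)
qed

section \<open>The sets \<open>H\<^sub>\<theta>\<close>\<close>

lemma regularD:
  assumes "regular \<theta>"
  shows "Ord \<theta>" "\<alpha> \<in> elts \<theta> \<Longrightarrow> elts \<alpha> \<prec> elts \<theta>" "infinite (elts \<theta>)"
    "X \<subseteq> elts \<theta> \<Longrightarrow> X \<prec> elts \<theta> \<Longrightarrow> \<exists>\<beta>\<in>elts \<theta>. X \<subseteq> elts \<beta>"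
  using assms unfolding regular_def cardinal_def by auto

lemma regular_lesspollE:
  assumes "regular \<theta>" "A \<prec> elts \<theta>"
  obtains \<beta> where "\<beta> \<in> elts \<theta>" "A \<lesssim> elts \<beta>"
proof -
  obtain f where f: "inj_on f A" "f ` A \<subseteq> elts \<theta>"
    using assms(2) unfolding lesspoll_def lepoll_def by blast
  have "f ` A \<prec> elts \<theta>"
    using f(1) assms(2) by simp
  then obtain \<beta> where "\<beta> \<in> elts \<theta>" "f ` A \<subseteq> elts \<beta>"
    using regularD(4)[OF assms(1) f(2)] by blast
  moreover from this have "A \<lesssim> elts \<beta>"
    using f(1) unfolding lepoll_def by blast
  ultimately show ?thesis
    using that by blast
qed

text \<open>Regularity bounds the index set and all the pieces by one ordinal \<mu> below \<theta>;
  if \<mu> is infinite, then \<mu> many sets of size at most \<mu> have a union of size at most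
  \<mu>.\<close>

lemma regular_UN_lesspoll:
  assumes \<theta>: "regular \<theta>" and I: "I \<prec> elts \<theta>" and A: "\<And>i. i \<in> I \<Longrightarrow> A i \<prec> elts \<theta>"
  shows "(\<Union>i\<in>I. A i) \<prec> elts \<theta>"
proof -
  have "\<exists>\<beta>. \<beta> \<in> elts \<theta> \<and> A i \<lesssim> elts \<beta>" if "i \<in> I" for i
    using regular_lesspollE[OF \<theta> A[OF that]] by blast
  then obtain b where b: "\<And>i. i \<in> I \<Longrightarrow> b i \<in> elts \<theta> \<and> A i \<lesssim> elts (b i)"
    by metis
  obtain \<delta> where \<delta>: "\<delta> \<in> elts \<theta>" "I \<lesssim> elts \<delta>"
    using regular_lesspollE[OF \<theta> I] .
  have "b ` I \<prec> elts \<theta>"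
    using image_lepoll I lesspoll_trans1 by blast
  moreover have "b ` I \<subseteq> elts \<theta>"
    using b by blast
  ultimately obtain \<gamma> where \<gamma>: "\<gamma> \<in> elts \<theta>" "b ` I \<subseteq> elts \<gamma>"
    using regularD(4)[OF \<theta>] by blast
  have sub: "elts (b i) \<subseteq> elts \<gamma>" if "i \<in> I" for i
    using \<gamma> that Ord_trans Ord_mem regularD(1)[OF \<theta>] by blast
  \<comment> \<open>The larger of the bound \<gamma> for the pieces and the bound \<delta> for the
    index set.\<close>
  define \<mu> where "\<mu> = (if \<gamma> \<in> elts \<delta> then \<delta> else \<gamma>)"
  have \<mu>: "\<mu> \<in> elts \<theta>" "elts \<gamma> \<subseteq> elts \<mu>" "elts \<delta> \<subseteq> elts \<mu>"
    using \<gamma>(1) \<delta>(1) Ord_linear[of \<gamma> \<delta>] Ord_mem[OF regularD(1)[OF \<theta>]] Ord_trans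
    unfolding \<mu>_def by (auto split: if_splits)
  have A\<mu>: "A i \<lesssim> elts \<mu>" if "i \<in> I" for i
    using b[OF that] sub[OF that] \<mu>(2) by (meson lepoll_trans subset_imp_lepoll)
  have I\<mu>: "I \<lesssim> elts \<mu>"
    using \<delta>(2) \<mu>(3) by (meson lepoll_trans subset_imp_lepoll)
  show ?thesis
  proof (cases "finite (elts \<mu>)")
    case True
    then have "finite (\<Union>i\<in>I. A i)"
      using A\<mu> I\<mu> by (metis finite_UN lepoll_iff finite_subset finite_imageI)
    then show ?thesis
      using finite_lesspoll_infinite regularD(3)[OF \<theta>] by blast
  next
    case False
    then have "(\<Union>i\<in>I. A i) \<lesssim> elts \<mu>"
      using infinite_UN_lepoll A\<mu> I\<mu> by blast
    then show ?thesis
      using regularD(2)[OF \<theta> \<mu>(1)] lesspoll_trans1 by blast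
  qed
qed

lemma regular_Un_lesspoll:
  fixes \<theta> :: "'v::zfc"
  assumes "regular \<theta>" "A \<prec> elts \<theta>" "B \<prec> elts \<theta>"
  shows "A \<union> B \<prec> elts \<theta>"
proof -
  have "(\<Union>b\<in>{True, False}. if b then A else B) \<prec> elts \<theta>"
  proof (rule regular_UN_lesspoll[OF assms(1)])
    show "{True, False} \<prec> elts \<theta>"
      by (rule finite_lesspoll_infinite[OF regularD(3)[OF assms(1)]]) simp
  qed (use assms in auto)
  then show ?thesis
    by (simp add: Un_commute)
qed

lemma H_trans: "x \<in> H \<theta> \<Longrightarrow> y \<in> elts x \<Longrightarrow> y \<in> H \<theta>"
  unfolding H_def using trcl_mono_mem lesspoll_trans1 subset_imp_lepoll by blast

lemma H_elts_lesspoll: "x \<in> H \<theta> \<Longrightarrow> elts x \<prec> elts \<theta>"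
  unfolding H_def using elts_subset_trcl lesspoll_trans1 subset_imp_lepoll by blast

lemma H_subset: "x \<in> H \<theta> \<Longrightarrow> elts y \<subseteq> elts x \<Longrightarrow> y \<in> H \<theta>"
proof -
  assume x: "x \<in> H \<theta>" and "elts y \<subseteq> elts x"
  then have "trcl y \<subseteq> trcl x"
    using trcl_unfold by blast
  then show ?thesis
    using x unfolding H_def using lesspoll_trans1 subset_imp_lepoll by blast
qed

text \<open>Here regularity matters: the transitive closure of X is a union of fewer than \<theta>
  sets, each of size below \<theta>. All later proofs that a set belongs to
  \<open>H \<theta>\<close> because it is small enough go through this.\<close>

lemma H_vset:
  assumes "regular \<theta>" "X \<subseteq> H \<theta>" "X \<prec> elts \<theta>"
  shows "small X" "vset X \<in> H \<theta>"
proof -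
  show s: "small X"
    using small_lepoll[OF lesspoll_imp_lepoll[OF assms(3)] small_elts] .
  have "(\<Union>x\<in>X. trcl x) \<prec> elts \<theta>"
    using assms by (intro regular_UN_lesspoll) (auto simp: H_def)
  then have "trcl (vset X) \<prec> elts \<theta>"
    using regular_Un_lesspoll[OF assms(1,3)] by (subst trcl_unfold) (simp add: s)
  then show "vset X \<in> H \<theta>"
    by (simp add: H_def)
qed

lemma H_finite: "regular \<theta> \<Longrightarrow> X \<subseteq> H \<theta> \<Longrightarrow> finite X \<Longrightarrow> vset X \<in> H \<theta>"
  using H_vset(2) finite_lesspoll_infinite[OF regularD(3)] by blast

lemma H_opair: "regular \<theta> \<Longrightarrow> x \<in> H \<theta> \<Longrightarrow> y \<in> H \<theta> \<Longrightarrow> opair x y \<in> H \<theta>"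
  unfolding opair_def by (simp add: H_finite)

lemma H_opairD: "opair x y \<in> H \<theta> \<Longrightarrow> x \<in> H \<theta> \<and> y \<in> H \<theta>"
proof -
  assume "opair x y \<in> H \<theta>"
  then have "vset {x, y} \<in> H \<theta>"
    by (rule H_trans) (simp add: elts_opair)
  then show ?thesis
    by (auto intro: H_trans simp: small_doubleton)
qed

lemma H_Ord:
  assumes "regular \<theta>" "\<alpha> \<in> elts \<theta>"
  shows "\<alpha> \<in> H \<theta>"
proof -
  have "Ord \<alpha>"
    using assms Ord_mem regularD(1) by blast
  then have "trcl \<alpha> \<subseteq> elts \<alpha>"
    by (intro trcl_least) (auto dest: Ord_trans)
  then show ?thesis
    using regularD(2)[OF assms] unfolding H_def
    using lesspoll_trans1 subset_imp_lepoll by blast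
qed

section \<open>Sufficiently large regular cardinals\<close>

lemma for_large_regular_H: "for_large_regular (\<lambda>\<theta>. x \<in> H \<theta>)" for x :: "'v::zfc"
proof -
  obtain \<alpha> :: 'v where "Ord \<alpha>" "elts \<alpha> \<approx> trcl x"
    using Ord_of_eqpoll[OF small_trcl[of x]] by blast
  then show ?thesis
    unfolding for_large_regular_def H_def mem_Collect_eq
    by (metis regularD(2) eq_lesspoll_trans eqpoll_sym)
qed

lemma for_large_regular_mem: "Ord \<alpha> \<Longrightarrow> for_large_regular (\<lambda>\<theta>. \<alpha> \<in> elts \<theta>)"
  unfolding for_large_regular_def by blast

lemma for_large_regular_conj:
  assumes "for_large_regular P" "for_large_regular Q"
  shows "for_large_regular (\<lambda>\<theta>. P \<theta> \<and> Q \<theta>)"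
proof -
  obtain \<alpha> \<beta> where \<alpha>: "Ord \<alpha>" "\<forall>\<theta>. regular \<theta> \<and> \<alpha> \<in> elts \<theta> \<longrightarrow> P \<theta>"
    and \<beta>: "Ord \<beta>" "\<forall>\<theta>. regular \<theta> \<and> \<beta> \<in> elts \<theta> \<longrightarrow> Q \<theta>"
    using assms unfolding for_large_regular_def by blast
  define \<gamma> where "\<gamma> = (if \<alpha> \<in> elts \<beta> then \<beta> else \<alpha>)"
  have "Ord \<gamma>"
    using \<alpha>(1) \<beta>(1) by (simp add: \<gamma>_def)
  moreover have "P \<theta> \<and> Q \<theta>" if "regular \<theta>" "\<gamma> \<in> elts \<theta>" for \<theta>
  proof -
    have "\<alpha> \<in> elts \<theta> \<and> \<beta> \<in> elts \<theta>"
      using that Ord_linear[OF \<alpha>(1) \<beta>(1)] Ord_trans[OF regularD(1)] 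
      unfolding \<gamma>_def by (auto split: if_splits)
    then show ?thesis
      using \<alpha>(2) \<beta>(2) that(1) by blast
  qed
  ultimately show ?thesis
    unfolding for_large_regular_def by blast
qed

lemma for_large_regular_mono:
  assumes "for_large_regular P" "\<And>\<theta>. regular \<theta> \<Longrightarrow> P \<theta> \<Longrightarrow> Q \<theta>"
  shows "for_large_regular Q"
  using assms unfolding for_large_regular_def by blast

text \<open>Makes no claim that regular cardinals are unbounded: if none lies beyond the threshold
  of P, then the same threshold serves Q vacuously.\<close>

lemma for_large_regular_witness:
  fixes P Q :: "'v::zfc \<Rightarrow> bool"
  assumes "for_large_regular P"
  shows "(\<exists>\<chi>. regular \<chi> \<and> P \<chi>) \<or> for_large_regular Q"
  using assms unfolding for_large_regular_def by blast

section \<open>Elementarity and definability in \<open>H\<^sub>\<theta>\<close>\<close>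

lemma elem_sub_witness:
  assumes "elem_sub I N A" "range e \<subseteq> N" "a \<in> A" "sat I A \<phi> (e(i := a))"
  shows "\<exists>b\<in>N. sat I A \<phi> (e(i := b))"
proof -
  have "sat I N (Ex i \<phi>) e"
    using assms unfolding elem_sub_def by (metis sat.simps(5))
  then obtain b where b: "b \<in> N" "sat I N \<phi> (e(i := b))"
    by auto
  moreover have "range (e(i := b)) \<subseteq> N"
    using assms(2) b(1) by auto
  ultimately show ?thesis
    using assms(1) unfolding elem_sub_def by blast
qed

lemma Tarski_Vaught:
  assumes "N \<noteq> {}" "N \<subseteq> A"
    and wit: "\<And>\<phi> i e a. range e \<subseteq> N \<Longrightarrow> a \<in> A \<Longrightarrow> sat I A \<phi> (e(i := a)) \<Longrightarrow>
      \<exists>b\<in>N. sat I A \<phi> (e(i := b))"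
  shows "elem_sub I N A"
proof -
  have "range e \<subseteq> N \<Longrightarrow> sat I N \<phi> e \<longleftrightarrow> sat I A \<phi> e" for \<phi> e
  proof (induction \<phi> arbitrary: e)
    case (Ex i \<phi>)
    have "sat I N \<phi> (e(i := a)) \<longleftrightarrow> sat I A \<phi> (e(i := a))" if "a \<in> N" for a
      using Ex that by (intro Ex.IH) auto
    then show ?case
      using wit[OF Ex.prems] assms(2) by auto
  qed auto
  then show ?thesis
    using assms(1,2) unfolding elem_sub_def by blast
qed

text \<open>Quantified variables are counted as well, so that every index from the bound on is
  fresh.\<close>

primrec var_bound :: "'r fm \<Rightarrow> nat" where
  "var_bound (Eq i j) = Suc (max i j)"
| "var_bound (Rel r i j) = Suc (max i j)"
| "var_bound (Neg \<phi>) = var_bound \<phi>"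
| "var_bound (Conj \<phi> \<psi>) = max (var_bound \<phi>) (var_bound \<psi>)"
| "var_bound (Ex i \<phi>) = max (Suc i) (var_bound \<phi>)"

lemma sat_cong:
  "(\<And>i. i < var_bound \<phi> \<Longrightarrow> e i = e' i) \<Longrightarrow> sat I A \<phi> e \<longleftrightarrow> sat I A \<phi> e'"
proof (induction \<phi> arbitrary: e e')
  case (Ex i \<phi>)
  have "sat I A \<phi> (e(i := a)) \<longleftrightarrow> sat I A \<phi> (e'(i := a))" for a
    by (rule Ex.IH) (use Ex.prems in auto)
  then show ?case
    by simp
next
  case (Neg \<phi>)
  have "sat I A \<phi> e \<longleftrightarrow> sat I A \<phi> e'"
    by (rule Neg.IH) (use Neg.prems in auto)
  then show ?case
    by simp
next
  case (Conj \<phi> \<psi>)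
  have "sat I A \<phi> e \<longleftrightarrow> sat I A \<phi> e'" "sat I A \<psi> e \<longleftrightarrow> sat I A \<psi> e'"
    by (rule Conj.IH; use Conj.prems in auto)+
  then show ?case
    by simp
qed auto

section \<open>The structure on \<open>H \<theta>\<close> and formulas for ordinals and
  cardinals\<close>

definition mem_ord_interp :: "('v::zfc \<times> 'v) set \<Rightarrow> mem_ord_sym \<Rightarrow> 'v \<Rightarrow> 'v \<Rightarrow> bool" where
  "mem_ord_interp \<Delta> = (\<lambda>r x y. case r of Mem_Sym \<Rightarrow> x \<in> elts y | Ord_Sym \<Rightarrow> (x, y) \<in> \<Delta>)"

lemma mem_ord_interp_simps [simp]:
  "mem_ord_interp \<Delta> Mem_Sym x y \<longleftrightarrow> x \<in> elts y"
  "mem_ord_interp \<Delta> Ord_Sym x y \<longleftrightarrow> (x, y) \<in> \<Delta>"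
  by (simp_all add: mem_ord_interp_def)

abbreviation "sat_H \<theta> \<Delta> \<equiv> sat (mem_ord_interp \<Delta>) (H \<theta>)"

abbreviation "FMem i j \<equiv> Rel Mem_Sym i j"
abbreviation "FAll i \<phi> \<equiv> Neg (Ex i (Neg \<phi>))"
abbreviation "FImp \<phi> \<psi> \<equiv> Neg (Conj \<phi> (Neg \<psi>))"

text \<open>
  In the formulas below the last argument \<open>s\<close> bounds the free variables strictly; the variables
  from \<open>s\<close> on are used as bound variables.
\<close>

definition fm_doubleton :: "nat \<Rightarrow> nat \<Rightarrow> nat \<Rightarrow> nat \<Rightarrow> mem_ord_sym fm" where
  "fm_doubleton u x y s = Conj (FMem x u) (Conj (FMem y u)
     (FAll s (FImp (FMem s u) (Neg (Conj (Neg (Eq s x)) (Neg (Eq s y)))))))"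

definition fm_opair :: "nat \<Rightarrow> nat \<Rightarrow> nat \<Rightarrow> nat \<Rightarrow> mem_ord_sym fm" where
  "fm_opair u x y s = Ex s (Ex (s + 1) (Conj (fm_doubleton s x x (s + 2))
     (Conj (fm_doubleton (s + 1) x y (s + 2)) (fm_doubleton u s (s + 1) (s + 2)))))"

definition fm_opair_mem :: "nat \<Rightarrow> nat \<Rightarrow> nat \<Rightarrow> nat \<Rightarrow> mem_ord_sym fm" where
  "fm_opair_mem f x y s = Ex s (Conj (FMem s f) (fm_opair s x y (s + 1)))"

text \<open>The witness is any set of pairs, not necessarily a function: each a in x has a partner b
  in y that is paired with no other element of x, and a choice of partners is injective.\<close>

definition fm_lepoll :: "nat \<Rightarrow> nat \<Rightarrow> nat \<Rightarrow> mem_ord_sym fm" where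
  "fm_lepoll x y s = Ex s (FAll (s + 1) (FImp (FMem (s + 1) x) (Ex (s + 2) (Conj (FMem (s + 2) y)
     (Conj (fm_opair_mem s (s + 1) (s + 2) (s + 4)) (FAll (s + 3) (FImp (FMem (s + 3) x)
       (FImp (fm_opair_mem s (s + 3) (s + 2) (s + 4)) (Eq (s + 3) (s + 1))))))))))"

definition fm_transitive :: "nat \<Rightarrow> nat \<Rightarrow> mem_ord_sym fm" where
  "fm_transitive x s =
     FAll s (FImp (FMem s x) (FAll (s + 1) (FImp (FMem (s + 1) s) (FMem (s + 1) x))))"

definition fm_Ord :: "nat \<Rightarrow> nat \<Rightarrow> mem_ord_sym fm" where
  "fm_Ord x s = Conj (fm_transitive x s) (FAll s (FImp (FMem s x) (fm_transitive s (s + 1))))"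

definition fm_limit :: "nat \<Rightarrow> nat \<Rightarrow> mem_ord_sym fm" where
  "fm_limit x s = Conj (Ex s (FMem s x))
     (FAll s (FImp (FMem s x) (Ex (s + 1) (Conj (FMem (s + 1) x) (FMem s (s + 1))))))"

text \<open>The definition of \<open>omega0\<close> speaks of finiteness in the logic; the formula
  describes the same ordinal as the least nonzero limit ordinal.\<close>

definition fm_omega0 :: "nat \<Rightarrow> nat \<Rightarrow> mem_ord_sym fm" where
  "fm_omega0 x s = Conj (fm_Ord x s)
     (Conj (fm_limit x s) (FAll s (FImp (FMem s x) (Neg (fm_limit s (s + 1))))))"

definition fm_card_succ :: "nat \<Rightarrow> nat \<Rightarrow> nat \<Rightarrow> mem_ord_sym fm" where
  "fm_card_succ k x s = Conj (fm_Ord x s)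
     (Conj (Neg (fm_lepoll x k s)) (FAll s (FImp (FMem s x) (fm_lepoll s k (s + 1)))))"

definition limit_ord :: "'v::zfc \<Rightarrow> bool" where
  "limit_ord x \<longleftrightarrow> elts x \<noteq> {} \<and> (\<forall>y\<in>elts x. \<exists>z\<in>elts x. y \<in> elts z)"

lemma sat_fm_doubleton:
  assumes "u < s" "x < s" "y < s" "e u \<in> H \<theta>"
  shows "sat_H \<theta> \<Delta> (fm_doubleton u x y s) e \<longleftrightarrow> elts (e u) = {e x, e y}"
  using assms by (auto simp: fm_doubleton_def intro: H_trans)

lemma sat_fm_opair:
  assumes "regular \<theta>" "u < s" "x < s" "y < s" "e u \<in> H \<theta>" "e x \<in> H \<theta>" "e y \<in> H \<theta>"
  shows "sat_H \<theta> \<Delta> (fm_opair u x y s) e \<longleftrightarrow> e u = opair (e x) (e y)"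
proof -
  have "sat_H \<theta> \<Delta> (fm_opair u x y s) e \<longleftrightarrow>
      (\<exists>a\<in>H \<theta>. \<exists>b\<in>H \<theta>. elts a = {e x} \<and> elts b = {e x, e y} \<and> elts (e u) = {a, b})"
    using assms by (auto simp: fm_opair_def sat_fm_doubleton)
  also have "\<dots> \<longleftrightarrow> e u = opair (e x) (e y)"
  proof
    assume "\<exists>a\<in>H \<theta>. \<exists>b\<in>H \<theta>. elts a = {e x} \<and> elts b = {e x, e y} \<and> elts (e u) = {a, b}"
    then obtain a b where ab: "elts a = {e x}" "elts b = {e x, e y}" "elts (e u) = {a, b}"
      by blast
    show "e u = opair (e x) (e y)"
      unfolding opair_def ab(1)[symmetric] ab(2)[symmetric] vset_elts ab(3)[symmetric] by simp
  next
    assume "e u = opair (e x) (e y)"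
    then have "elts (e u) = {vset {e x}, vset {e x, e y}}"
      by (simp add: elts_opair)
    moreover have "vset {e x} \<in> H \<theta>" "vset {e x, e y} \<in> H \<theta>"
      using assms by (auto intro!: H_finite)
    ultimately show "\<exists>a\<in>H \<theta>. \<exists>b\<in>H \<theta>. elts a = {e x} \<and> elts b = {e x, e y} \<and> elts (e u) = {a, b}"
      by (intro bexI[of _ "vset {e x}"] bexI[of _ "vset {e x, e y}"])
        (simp_all add: small_doubleton small_singleton)
  qed
  finally show ?thesis .
qed

lemma sat_fm_opair_mem:
  assumes "regular \<theta>" "f < s" "x < s" "y < s" "e f \<in> H \<theta>" "e x \<in> H \<theta>" "e y \<in> H \<theta>"
  shows "sat_H \<theta> \<Delta> (fm_opair_mem f x y s) e \<longleftrightarrow> opair (e x) (e y) \<in> elts (e f)"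
  using assms H_opair[OF assms(1,6,7)] by (auto simp: fm_opair_mem_def sat_fm_opair)

text \<open>The relation is absolute because the graph of an injection from a member of
  \<open>H \<theta>\<close> has fewer than \<theta> elements, all in \<open>H \<theta>\<close>, and
  is therefore itself a member.\<close>

lemma sat_fm_lepoll:
  assumes \<theta>: "regular \<theta>" and "x < s" "y < s" and x: "e x \<in> H \<theta>" and y: "e y \<in> H \<theta>"
  shows "sat_H \<theta> \<Delta> (fm_lepoll x y s) e \<longleftrightarrow> elts (e x) \<lesssim> elts (e y)"
proof -
  have "sat_H \<theta> \<Delta> (fm_lepoll x y s) e \<longleftrightarrow>
      (\<exists>f\<in>H \<theta>. \<forall>a\<in>H \<theta>. a \<in> elts (e x) \<longrightarrow> (\<exists>b\<in>H \<theta>. b \<in> elts (e y) \<and> opair a b \<in> elts f \<and>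
        (\<forall>a'\<in>H \<theta>. a' \<in> elts (e x) \<longrightarrow> opair a' b \<in> elts f \<longrightarrow> a' = a)))"
    using assms by (simp add: fm_lepoll_def sat_fm_opair_mem)
  also have "\<dots> \<longleftrightarrow> (\<exists>f\<in>H \<theta>. \<forall>a\<in>elts (e x). \<exists>b\<in>elts (e y). opair a b \<in> elts f \<and>
        (\<forall>a'\<in>elts (e x). opair a' b \<in> elts f \<longrightarrow> a' = a))"
    using H_trans[OF x] H_trans[OF y] by metis
  also have "\<dots> \<longleftrightarrow> elts (e x) \<lesssim> elts (e y)"
  proof
    assume "\<exists>f\<in>H \<theta>. \<forall>a\<in>elts (e x). \<exists>b\<in>elts (e y). opair a b \<in> elts f \<and>
        (\<forall>a'\<in>elts (e x). opair a' b \<in> elts f \<longrightarrow> a' = a)"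
    then obtain f h where "\<And>a. a \<in> elts (e x) \<Longrightarrow> h a \<in> elts (e y) \<and> opair a (h a) \<in> elts f \<and>
        (\<forall>a'\<in>elts (e x). opair a' (h a) \<in> elts f \<longrightarrow> a' = a)"
      by metis
    then have "inj_on h (elts (e x))" "h ` elts (e x) \<subseteq> elts (e y)"
      by (auto simp: inj_on_def) metis
    then show "elts (e x) \<lesssim> elts (e y)"
      unfolding lepoll_def by blast
  next
    assume "elts (e x) \<lesssim> elts (e y)"
    then obtain h where h: "inj_on h (elts (e x))" "h ` elts (e x) \<subseteq> elts (e y)"
      unfolding lepoll_def by blast
    let ?F = "(\<lambda>a. opair a (h a)) ` elts (e x)"
    have "?F \<subseteq> H \<theta>"
      using H_opair[OF \<theta>] H_trans[OF x] H_trans[OF y] h(2) by blast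
    moreover have "?F \<prec> elts \<theta>"
      using image_lepoll H_elts_lesspoll[OF x] lesspoll_trans1 by blast
    ultimately have "small ?F" "vset ?F \<in> H \<theta>"
      using H_vset[OF \<theta>] by blast+
    show "\<exists>f\<in>H \<theta>. \<forall>a\<in>elts (e x). \<exists>b\<in>elts (e y). opair a b \<in> elts f \<and>
        (\<forall>a'\<in>elts (e x). opair a' b \<in> elts f \<longrightarrow> a' = a)"
    proof (rule bexI[of _ "vset ?F"], rule ballI)
      fix a assume a: "a \<in> elts (e x)"
      show "\<exists>b\<in>elts (e y). opair a b \<in> elts (vset ?F) \<and>
          (\<forall>a'\<in>elts (e x). opair a' b \<in> elts (vset ?F) \<longrightarrow> a' = a)"
        using h a \<open>small ?F\<close> by (intro bexI[of _ "h a"]) (auto dest: inj_onD)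
    qed fact
  qed
  finally show ?thesis .
qed

lemma sat_fm_transitive:
  assumes "x < s" "e x \<in> H \<theta>"
  shows "sat_H \<theta> \<Delta> (fm_transitive x s) e \<longleftrightarrow> transitive_set (elts (e x))"
  using assms by (simp add: fm_transitive_def transitive_set_def subset_iff) (meson H_trans)

lemma sat_fm_Ord:
  assumes "x < s" "e x \<in> H \<theta>"
  shows "sat_H \<theta> \<Delta> (fm_Ord x s) e \<longleftrightarrow> Ord (e x)"
  using assms by (auto simp: fm_Ord_def Ord_def sat_fm_transitive intro: H_trans)

lemma sat_fm_limit:
  assumes "x < s" "e x \<in> H \<theta>"
  shows "sat_H \<theta> \<Delta> (fm_limit x s) e \<longleftrightarrow> limit_ord (e x)"
  using assms by (auto simp: fm_limit_def limit_ord_def intro: H_trans)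

lemma sat_fm_card_succ:
  assumes "regular \<theta>" "k < s" "x < s" "e k \<in> H \<theta>" "e x \<in> H \<theta>"
  shows "sat_H \<theta> \<Delta> (fm_card_succ k x s) e \<longleftrightarrow> e x = card_succ (e k)"
proof -
  have "sat_H \<theta> \<Delta> (fm_card_succ k x s) e \<longleftrightarrow>
      Ord (e x) \<and> \<not> elts (e x) \<lesssim> elts (e k) \<and> (\<forall>b\<in>elts (e x). elts b \<lesssim> elts (e k))"
    using assms by (auto simp: fm_card_succ_def sat_fm_Ord sat_fm_lepoll intro: H_trans)
  also have "\<dots> \<longleftrightarrow> e x = card_succ (e k)"
    using card_succ_eqI card_succ_spec not_lepoll_iff_lesspoll by metis
  finally show ?thesis .
qed

text \<open>On a finite ordinal the converse of membership is well-founded, so that a nonempty one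
  has a largest element.\<close>

lemma limit_ord_infinite:
  assumes "limit_ord x" "Ord x"
  shows "infinite (elts x)"
proof
  assume fin: "finite (elts x)"
  define r where "r = {(a, b). a \<in> elts x \<and> b \<in> elts x \<and> a \<in> elts b}"
  have "r \<subseteq> elts x \<times> elts x"
    by (auto simp: r_def)
  then have "finite r"
    using fin finite_subset by blast
  moreover have "trans r"
    using assms(2) unfolding r_def trans_def Ord_def transitive_set_def by blast
  then have "acyclic (r\<inverse>)"
    unfolding acyclic_converse acyclic_def by (simp add: r_def mem_not_refl trancl_id)
  ultimately have "wf (r\<inverse>)"
    using finite_acyclic_wf by blast
  moreover obtain a where "a \<in> elts x"
    using assms(1) unfolding limit_ord_def by blast
  ultimately obtain z where "z \<in> elts x" "\<And>y. (y, z) \<in> r\<inverse> \<Longrightarrow> y \<notin> elts x"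
    by (rule wfE_min) auto
  then show False
    using assms(1) unfolding limit_ord_def r_def by blast
qed

lemma omega0_limit: "limit_ord (omega0 :: 'v::zfc)"
  unfolding limit_ord_def
proof (intro conjI ballI)
  show "elts (omega0 :: 'v) \<noteq> {}"
    using omega0_spec(2) by (metis finite.emptyI)
  fix y :: 'v assume y: "y \<in> elts omega0"
  let ?s = "vset (insert y (elts y))"
  have s: "Ord ?s" "elts ?s = insert y (elts y)"
    using Ord_succ Ord_mem[OF omega0_spec(1) y] by (auto simp: small_insert)
  then have "finite (elts ?s)"
    using omega0_spec(3)[OF y] by simp
  then have "?s \<in> elts omega0"
    using Ord_linear[OF s(1) omega0_spec(1)] omega0_spec(2) Ord_trans[OF s(1)]
    by (metis finite_subset)
  then show "\<exists>z\<in>elts omega0. y \<in> elts z"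
    using s(2) by blast
qed

lemma sat_fm_omega0:
  assumes "x < s" "e x \<in> H \<theta>"
  shows "sat_H \<theta> \<Delta> (fm_omega0 x s) e \<longleftrightarrow> e x = omega0"
proof -
  have "sat_H \<theta> \<Delta> (fm_omega0 x s) e \<longleftrightarrow>
      Ord (e x) \<and> limit_ord (e x) \<and> (\<forall>b\<in>elts (e x). \<not> limit_ord b)"
    using assms by (auto simp: fm_omega0_def sat_fm_Ord sat_fm_limit intro: H_trans)
  also have "\<dots> \<longleftrightarrow> e x = omega0"
    using Ord_linear[OF _ omega0_spec(1), of "e x"] omega0_limit omega0_spec limit_ord_infinite
      Ord_mem[OF omega0_spec(1)] by metis
  finally show ?thesis .
qed

text \<open>Each of these ordinals is the only solution in \<open>H \<theta>\<close> of a formula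
  with parameters already found in N. The element c merely fills the assignment.\<close>

lemma omega_mem_elem_sub:
  fixes N :: "'v::zfc set"
  assumes \<theta>: "regular \<theta>" "omega2 \<in> elts \<theta>"
    and N: "elem_sub (mem_ord_interp \<Delta>) N (H \<theta>)"
  shows "omega0 \<in> N" "omega2 \<in> N"
proof -
  have o: "omega0 \<in> H \<theta>" "omega1 \<in> H \<theta>" "omega2 \<in> H \<theta>"
    using omega_facts \<theta> Ord_trans[OF regularD(1)[OF \<theta>(1)] \<theta>(2)] by (auto intro!: H_Ord)
  have NH: "N \<subseteq> H \<theta>"
    using N unfolding elem_sub_def by blast
  obtain c where c: "c \<in> N"
    using N unfolding elem_sub_def by blast
  obtain a where "a \<in> N" "sat_H \<theta> \<Delta> (fm_omega0 0 1) ((\<lambda>_. c)(0 := a))"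
    using elem_sub_witness[OF N, of "\<lambda>_. c" omega0 "fm_omega0 0 1" 0] c o
    by (auto simp: sat_fm_omega0)
  then show 0: "omega0 \<in> N"
    using NH by (auto simp: sat_fm_omega0)
  have step: "card_succ k \<in> N" if k: "k \<in> N" "card_succ k \<in> H \<theta>" for k
  proof -
    obtain a where "a \<in> N" "sat_H \<theta> \<Delta> (fm_card_succ 1 0 2) ((\<lambda>_. k)(0 := a))"
      using elem_sub_witness[OF N, of "\<lambda>_. k" "card_succ k" "fm_card_succ 1 0 2" 0] k NH \<theta>(1)
      by (auto simp: sat_fm_card_succ subset_iff)
    then show ?thesis
      using NH k \<theta>(1) by (auto simp: sat_fm_card_succ subset_iff)
  qed
  have "omega1 \<in> N"
    using step[OF 0] o unfolding omega1_def by blast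
  then show "omega2 \<in> N"
    using step o unfolding omega2_def by blast
qed

section \<open>Functions in an elementary submodel\<close>

text \<open>Elements that are not pairs are permitted and no domain is prescribed, so that such sets
  act as partial functions.\<close>

definition single_valued_set :: "'v::zfc \<Rightarrow> bool" where
  "single_valued_set f \<longleftrightarrow>
     (\<forall>x y y'. opair x y \<in> elts f \<longrightarrow> opair x y' \<in> elts f \<longrightarrow> y = y')"

text \<open>By \<open>unique\<close> the graph is no larger than d, which puts it into
  \<open>H \<theta>\<close>. There it is the only solution of a formula with parameters in N, and so
  it lies in N.\<close>

lemma definable_function_mem:
  assumes \<theta>: "regular \<theta>" and N: "elem_sub (mem_ord_interp \<Delta>) N (H \<theta>)"
    and d: "d \<in> N" and e: "range e \<subseteq> N"
    and unique: "\<And>\<beta> x y. \<beta> \<in> elts d \<Longrightarrow> x \<in> H \<theta> \<Longrightarrow> y \<in> H \<theta> \<Longrightarrow>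
      sat_H \<theta> \<Delta> \<phi> (e(b := \<beta>, z := x)) \<Longrightarrow> sat_H \<theta> \<Delta> \<phi> (e(b := \<beta>, z := y)) \<Longrightarrow> x = y"
    and bz: "b \<noteq> z"
  shows "\<exists>g\<in>N. elts g =
    {opair \<beta> x |\<beta> x. \<beta> \<in> elts d \<and> x \<in> H \<theta> \<and> sat_H \<theta> \<Delta> \<phi> (e(b := \<beta>, z := x))}"
proof -
  let ?G = "{opair \<beta> x |\<beta> x. \<beta> \<in> elts d \<and> x \<in> H \<theta> \<and> sat_H \<theta> \<Delta> \<phi> (e(b := \<beta>, z := x))}"
  \<comment> \<open>Slot n is for the graph, n + 1 for d and n + 2 for a member of the graph; all
    three lie beyond b, z and the variables of \<phi>.\<close>
  define n where "n = Suc (max (var_bound \<phi>) (max b z))"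
  have n: "var_bound \<phi> < n" "b < n" "z < n"
    by (auto simp: n_def)
  have NH: "N \<subseteq> H \<theta>"
    using N unfolding elem_sub_def by blast
  have dH: "d \<in> H \<theta>" and elts_d: "\<beta> \<in> elts d \<Longrightarrow> \<beta> \<in> H \<theta>" for \<beta>
    using d NH H_trans by blast+
  define e' where "e' = e(n + 1 := d)"
  have e': "range e' \<subseteq> N"
    using e d by (auto simp: e'_def)
  define \<psi> where "\<psi> = Ex b (Ex z (Conj (FMem b (n + 1)) (Conj (fm_opair (n + 2) b z (n + 3)) \<phi>)))"
  define \<chi> where
    "\<chi> = FAll (n + 2) (Conj (FImp (FMem (n + 2) n) \<psi>) (FImp \<psi> (FMem (n + 2) n)))"
  have \<phi>: "sat_H \<theta> \<Delta> \<phi> (e'(n := g, n + 2 := u, b := \<beta>, z := x)) \<longleftrightarrow>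
      sat_H \<theta> \<Delta> \<phi> (e(b := \<beta>, z := x))" for g u \<beta> x
    by (rule sat_cong) (use n in \<open>auto simp: e'_def\<close>)
  have \<psi>: "sat_H \<theta> \<Delta> \<psi> (e'(n := g, n + 2 := u)) \<longleftrightarrow> u \<in> ?G" if "u \<in> H \<theta>" for g u
  proof -
    have "sat_H \<theta> \<Delta> \<psi> (e'(n := g, n + 2 := u)) \<longleftrightarrow> (\<exists>\<beta>\<in>H \<theta>. \<exists>x\<in>H \<theta>. \<beta> \<in> elts d \<and>
        u = opair \<beta> x \<and> sat_H \<theta> \<Delta> \<phi> (e'(n := g, n + 2 := u, b := \<beta>, z := x)))"
      using n bz that by (simp add: \<psi>_def sat_fm_opair[OF \<theta>] e'_def)
    then show ?thesis
      unfolding \<phi> using elts_d by blast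
  qed
  have \<chi>: "sat_H \<theta> \<Delta> \<chi> (e'(n := g)) \<longleftrightarrow> elts g = ?G" if "g \<in> H \<theta>" for g
  proof -
    have "sat_H \<theta> \<Delta> \<chi> (e'(n := g)) \<longleftrightarrow>
        (\<forall>u\<in>H \<theta>. u \<in> elts g \<longleftrightarrow> sat_H \<theta> \<Delta> \<psi> (e'(n := g, n + 2 := u)))"
      by (auto simp: \<chi>_def)
    also have "\<dots> \<longleftrightarrow> (\<forall>u\<in>H \<theta>. u \<in> elts g \<longleftrightarrow> u \<in> ?G)"
      using \<psi> by simp
    also have "\<dots> \<longleftrightarrow> elts g = ?G"
      using H_trans[OF that] H_opair[OF \<theta> elts_d] by blast
    finally show ?thesis .
  qed
  have "?G \<subseteq> (\<lambda>\<beta>. opair \<beta> (SOME x. x \<in> H \<theta> \<and> sat_H \<theta> \<Delta> \<phi> (e(b := \<beta>, z := x)))) ` elts d"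
  proof
    fix u assume "u \<in> ?G"
    then obtain \<beta> x where u: "u = opair \<beta> x" "\<beta> \<in> elts d"
      and x: "x \<in> H \<theta> \<and> sat_H \<theta> \<Delta> \<phi> (e(b := \<beta>, z := x))"
      by blast
    have "(SOME x. x \<in> H \<theta> \<and> sat_H \<theta> \<Delta> \<phi> (e(b := \<beta>, z := x))) = x"
      using x unique[OF u(2)] by (intro some_equality) blast+
    then show "u \<in> (\<lambda>\<beta>. opair \<beta> (SOME x. x \<in> H \<theta> \<and> sat_H \<theta> \<Delta> \<phi> (e(b := \<beta>, z := x)))) ` elts d"
      using u by blast
  qed
  then have "?G \<lesssim> elts d"
    by (rule subset_image_lepoll)
  then have "?G \<prec> elts \<theta>"
    using H_elts_lesspoll[OF dH] lesspoll_trans1 by blast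
  moreover have "?G \<subseteq> H \<theta>"
    using H_opair[OF \<theta> elts_d] by blast
  ultimately have "small ?G" "vset ?G \<in> H \<theta>"
    using H_vset[OF \<theta>] by blast+
  then have "sat_H \<theta> \<Delta> \<chi> (e'(n := vset ?G))"
    using \<chi> by simp
  then obtain g where "g \<in> N" "sat_H \<theta> \<Delta> \<chi> (e'(n := g))"
    using elem_sub_witness[OF N e' \<open>vset ?G \<in> H \<theta>\<close>] by blast
  then show ?thesis
    using \<chi> NH by blast
qed

text \<open>For an elementary submodel N and \<alpha> in a member of N this is the Skolem hull of N
  and \<alpha>.\<close>

definition function_values :: "'v::zfc set \<Rightarrow> 'v \<Rightarrow> 'v set" where
  "function_values N \<alpha> = {x. \<exists>f\<in>N. single_valued_set f \<and> opair \<alpha> x \<in> elts f}"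

text \<open>Constant functions yield N and the identity on d yields \<alpha>. For the Tarski-Vaught
  criterion, parameters that are values at \<alpha> of functions \<open>F j\<close> in N are
  replaced by the values at a variable \<beta>; the map from \<beta> to the least witness is
  definable over N, hence in N.\<close>

lemma function_values_elem_sub:
  fixes N :: "'v::zfc set"
  assumes \<theta>: "regular \<theta>" and wo: "well_order_on (H \<theta>) \<Delta>"
    and N: "elem_sub (mem_ord_interp \<Delta>) N (H \<theta>)"
    and d: "d \<in> N" and \<alpha>: "\<alpha> \<in> elts d"
  shows "N \<subseteq> function_values N \<alpha>" "\<alpha> \<in> function_values N \<alpha>"
    "elem_sub (mem_ord_interp \<Delta>) (function_values N \<alpha>) (H \<theta>)"
proof -
  have NH: "N \<subseteq> H \<theta>"
    using N unfolding elem_sub_def by blast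
  have \<alpha>H: "\<alpha> \<in> H \<theta>"
    using d \<alpha> NH H_trans by blast
  show const: "N \<subseteq> function_values N \<alpha>"
  proof
    fix a assume a: "a \<in> N"
    have "\<exists>g\<in>N. elts g = {opair \<beta> x |\<beta> x. \<beta> \<in> elts d \<and> x \<in> H \<theta> \<and>
        sat_H \<theta> \<Delta> (Eq 1 2) ((\<lambda>_. a)(0 := \<beta>, 1 := x))}"
      using a by (intro definable_function_mem[OF \<theta> N d]) auto
    then obtain g where "g \<in> N" and
      "elts g = {opair \<beta> x |\<beta> x. \<beta> \<in> elts d \<and> x \<in> H \<theta> \<and> x = a}"
      by auto
    then show "a \<in> function_values N \<alpha>"
      unfolding function_values_def single_valued_set_def using a \<alpha> NH
      by (intro CollectI bexI[of _ g]) auto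
  qed
  show "\<alpha> \<in> function_values N \<alpha>"
  proof -
    have "\<exists>g\<in>N. elts g = {opair \<beta> x |\<beta> x. \<beta> \<in> elts d \<and> x \<in> H \<theta> \<and>
        sat_H \<theta> \<Delta> (Eq 1 0) ((\<lambda>_. d)(0 := \<beta>, 1 := x))}"
      using d by (intro definable_function_mem[OF \<theta> N d]) auto
    then obtain g where "g \<in> N" and
      "elts g = {opair \<beta> x |\<beta> x. \<beta> \<in> elts d \<and> x \<in> H \<theta> \<and> x = \<beta>}"
      by auto
    then show ?thesis
      unfolding function_values_def single_valued_set_def using \<alpha> \<alpha>H
      by (intro CollectI bexI[of _ g]) auto
  qed
  show "elem_sub (mem_ord_interp \<Delta>) (function_values N \<alpha>) (H \<theta>)"
  proof (rule Tarski_Vaught)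
    show "function_values N \<alpha> \<noteq> {}"
      using const d by blast
    show "function_values N \<alpha> \<subseteq> H \<theta>"
      unfolding function_values_def using NH H_trans H_opairD by blast
    fix \<phi> i e a
    assume e: "range e \<subseteq> function_values N \<alpha>" and a: "a \<in> H \<theta>" "sat_H \<theta> \<Delta> \<phi> (e(i := a))"
    have "\<forall>j. \<exists>f. f \<in> N \<and> single_valued_set f \<and> opair \<alpha> (e j) \<in> elts f"
      using e unfolding function_values_def by blast
    then obtain F where F: "\<And>j. F j \<in> N" "\<And>j. single_valued_set (F j)"
      "\<And>j. opair \<alpha> (e j) \<in> elts (F j)"
      by metis
    define n where "n = Suc (max (var_bound \<phi>) i)"
    have n: "var_bound \<phi> < n" "i < n"
      by (auto simp: n_def)
    \<comment> \<open>Quantifying over i with i equal to n substitutes variable n for i in \<phi>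
      without renaming.\<close>
    define least where
      "least = Conj (Ex i (Conj (Eq i n) \<phi>)) (FAll i (FImp \<phi> (Rel Ord_Sym n i)))"
    have least: "sat_H \<theta> \<Delta> least h \<longleftrightarrow> h n \<in> H \<theta> \<and> sat_H \<theta> \<Delta> \<phi> (h(i := h n)) \<and>
        (\<forall>c\<in>H \<theta>. sat_H \<theta> \<Delta> \<phi> (h(i := c)) \<longrightarrow> (h n, c) \<in> \<Delta>)" for h
      using n by (auto simp: least_def)
    \<comment> \<open>\<open>blk n\<close> expresses that variable \<open>n\<close> is the \<open>\<Delta>\<close>-least witness for \<open>\<phi>\<close> when the
      variables \<open>j < n\<close> take the values \<open>F j\<close> at \<open>\<beta>\<close>; variable \<open>n + 1\<close> holds \<open>\<beta>\<close> and
      \<open>n + 2 + j\<close> holds \<open>F j\<close>.\<close>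
    define blk where "blk = rec_nat least
      (\<lambda>m \<psi>. Ex m (Conj (fm_opair_mem (n + 2 + m) (n + 1) m (2 * n + 2)) \<psi>))"
    \<comment> \<open>The number \<open>2 * n + 2\<close> is the first index beyond the slots
      \<open>n + 2 + j\<close> with j < n.\<close>
    have blk_simps: "blk 0 = least"
      "blk (Suc m) = Ex m (Conj (fm_opair_mem (n + 2 + m) (n + 1) m (2 * n + 2)) (blk m))" for m
      by (simp_all add: blk_def)
    have blk: "sat_H \<theta> \<Delta> (blk m) h \<longleftrightarrow>
        (\<exists>x. (\<forall>j<m. x j \<in> H \<theta> \<and> opair \<beta> (x j) \<in> elts (F j)) \<and>
          sat_H \<theta> \<Delta> least (\<lambda>j. if j < m then x j else h j))"
      if "m \<le> n" "h (n + 1) = \<beta>" "\<beta> \<in> H \<theta>" "\<And>j. j < n \<Longrightarrow> h (n + 2 + j) = F j" for m h \<beta>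
      using that
    proof (induction m arbitrary: h)
      case 0
      then show ?case
        by (simp add: blk_simps)
    next
      case (Suc m)
      have FH: "F m \<in> H \<theta>"
        using F(1) NH by blast
      have IH: "sat_H \<theta> \<Delta> (blk m) (h(m := c)) \<longleftrightarrow>
        (\<exists>x. (\<forall>j<m. x j \<in> H \<theta> \<and> opair \<beta> (x j) \<in> elts (F j)) \<and>
          sat_H \<theta> \<Delta> least (\<lambda>j. if j < m then x j else (h(m := c)) j))" for c
        by (rule Suc.IH) (use Suc.prems in auto)
      have "sat_H \<theta> \<Delta> (blk (Suc m)) h \<longleftrightarrow>
          (\<exists>c\<in>H \<theta>. opair \<beta> c \<in> elts (F m) \<and> sat_H \<theta> \<Delta> (blk m) (h(m := c)))"
        using Suc.prems FH Suc.prems(4)[of m] by (simp add: blk_simps sat_fm_opair_mem[OF \<theta>])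
      also have "\<dots> \<longleftrightarrow> (\<exists>x. (\<forall>j<Suc m. x j \<in> H \<theta> \<and> opair \<beta> (x j) \<in> elts (F j)) \<and>
          sat_H \<theta> \<Delta> least (\<lambda>j. if j < Suc m then x j else h j))"
      proof
        assume "\<exists>c\<in>H \<theta>. opair \<beta> c \<in> elts (F m) \<and> sat_H \<theta> \<Delta> (blk m) (h(m := c))"
        then obtain c x where c: "c \<in> H \<theta>" "opair \<beta> c \<in> elts (F m)"
          and x: "\<forall>j<m. x j \<in> H \<theta> \<and> opair \<beta> (x j) \<in> elts (F j)"
            "sat_H \<theta> \<Delta> least (\<lambda>j. if j < m then x j else (h(m := c)) j)"
          using IH by blast
        have "(\<lambda>j. if j < m then x j else (h(m := c)) j) =
            (\<lambda>j. if j < Suc m then (x(m := c)) j else h j)"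
          by auto
        then show "\<exists>x. (\<forall>j<Suc m. x j \<in> H \<theta> \<and> opair \<beta> (x j) \<in> elts (F j)) \<and>
            sat_H \<theta> \<Delta> least (\<lambda>j. if j < Suc m then x j else h j)"
          using c x by (intro exI[of _ "x(m := c)"]) (auto simp: less_Suc_eq)
      next
        assume "\<exists>x. (\<forall>j<Suc m. x j \<in> H \<theta> \<and> opair \<beta> (x j) \<in> elts (F j)) \<and>
            sat_H \<theta> \<Delta> least (\<lambda>j. if j < Suc m then x j else h j)"
        then obtain x where x: "\<forall>j<Suc m. x j \<in> H \<theta> \<and> opair \<beta> (x j) \<in> elts (F j)"
            "sat_H \<theta> \<Delta> least (\<lambda>j. if j < Suc m then x j else h j)"
          by blast
        have "(\<lambda>j. if j < Suc m then x j else h j) =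
            (\<lambda>j. if j < m then x j else (h(m := x m)) j)"
          by (auto simp: less_Suc_eq)
        then have "sat_H \<theta> \<Delta> (blk m) (h(m := x m))"
          unfolding IH using x by (intro exI[of _ x]) auto
        then show "\<exists>c\<in>H \<theta>. opair \<beta> c \<in> elts (F m) \<and> sat_H \<theta> \<Delta> (blk m) (h(m := c))"
          using x(1) by blast
      qed
      finally show ?case .
    qed
    \<comment> \<open>Slots n and n + 1 are overwritten below and those under n are bound in
      \<open>blk n\<close>; d is just a member of N to fill them.\<close>
    define h where "h j = (if n + 2 \<le> j then F (j - (n + 2)) else d)" for j
    have h: "range h \<subseteq> N"
      using F(1) d by (auto simp: h_def)
    have blk_n: "sat_H \<theta> \<Delta> (blk n) (h(n + 1 := \<beta>, n := y)) \<longleftrightarrow> y \<in> H \<theta> \<and>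
        (\<exists>x. (\<forall>j<n. opair \<beta> (x j) \<in> elts (F j)) \<and> sat_H \<theta> \<Delta> \<phi> (x(i := y)) \<and>
          (\<forall>c\<in>H \<theta>. sat_H \<theta> \<Delta> \<phi> (x(i := c)) \<longrightarrow> (y, c) \<in> \<Delta>))" if \<beta>: "\<beta> \<in> H \<theta>" for \<beta> y
    proof -
      have H1: "opair \<beta> c \<in> elts (F j) \<Longrightarrow> c \<in> H \<theta>" for c j
        using F(1) NH H_trans H_opairD by blast
      have eq: "sat_H \<theta> \<Delta> \<phi> ((\<lambda>j. if j < n then x j else (h(n + 1 := \<beta>, n := y)) j)(i := c)) \<longleftrightarrow>
          sat_H \<theta> \<Delta> \<phi> (x(i := c))" for x c
        by (rule sat_cong) (use n in auto)
      have "sat_H \<theta> \<Delta> (blk n) (h(n + 1 := \<beta>, n := y)) \<longleftrightarrow>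
        (\<exists>x. (\<forall>j<n. x j \<in> H \<theta> \<and> opair \<beta> (x j) \<in> elts (F j)) \<and>
          sat_H \<theta> \<Delta> least (\<lambda>j. if j < n then x j else (h(n + 1 := \<beta>, n := y)) j))"
        by (rule blk) (use \<beta> in \<open>auto simp: h_def\<close>)
      moreover have "(\<forall>j<n. x j \<in> H \<theta> \<and> opair \<beta> (x j) \<in> elts (F j)) \<longleftrightarrow>
          (\<forall>j<n. opair \<beta> (x j) \<in> elts (F j))" for x
        using H1 by blast
      ultimately show ?thesis
        unfolding least eq by auto
    qed
    have as: "antisym \<Delta>"
      using wo by (simp add: order_on_defs)
    have uniq: "y = y'" if \<beta>: "\<beta> \<in> elts d" and "y \<in> H \<theta>" "y' \<in> H \<theta>"
        and sy: "sat_H \<theta> \<Delta> (blk n) (h(n + 1 := \<beta>, n := y))"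
        and sy': "sat_H \<theta> \<Delta> (blk n) (h(n + 1 := \<beta>, n := y'))" for \<beta> y y'
    proof -
      have \<beta>H: "\<beta> \<in> H \<theta>"
        using \<beta> d NH H_trans by blast
      obtain x where x: "\<forall>j<n. opair \<beta> (x j) \<in> elts (F j)" "sat_H \<theta> \<Delta> \<phi> (x(i := y))"
        "\<forall>c\<in>H \<theta>. sat_H \<theta> \<Delta> \<phi> (x(i := c)) \<longrightarrow> (y, c) \<in> \<Delta>"
        using sy unfolding blk_n[OF \<beta>H] by blast
      obtain x' where x': "\<forall>j<n. opair \<beta> (x' j) \<in> elts (F j)" "sat_H \<theta> \<Delta> \<phi> (x'(i := y'))"
        "\<forall>c\<in>H \<theta>. sat_H \<theta> \<Delta> \<phi> (x'(i := c)) \<longrightarrow> (y', c) \<in> \<Delta>"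
        using sy' unfolding blk_n[OF \<beta>H] by blast
      \<comment> \<open>The functions \<open>F j\<close> determine the parameters at \<beta>;
        antisymmetry of \<Delta> then settles the witness.\<close>
      have "x j = x' j" if "j < n" for j
        using x(1) x'(1) F(2)[of j] that unfolding single_valued_set_def by blast
      then have "sat_H \<theta> \<Delta> \<phi> (x(i := c)) \<longleftrightarrow> sat_H \<theta> \<Delta> \<phi> (x'(i := c))" for c
        by (intro sat_cong) (use n in auto)
      then show "y = y'"
        using x x' \<open>y \<in> H \<theta>\<close> \<open>y' \<in> H \<theta>\<close> antisymD[OF as] by blast
    qed
    have "\<exists>g\<in>N. elts g = {opair \<beta> x |\<beta> x. \<beta> \<in> elts d \<and> x \<in> H \<theta> \<and>
        sat_H \<theta> \<Delta> (blk n) (h(n + 1 := \<beta>, n := x))}"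
      by (rule definable_function_mem[OF \<theta> N d h]) (use uniq in blast, simp)
    then obtain g where g: "g \<in> N" and g_elts: "elts g = {opair \<beta> x |\<beta> x. \<beta> \<in> elts d \<and> x \<in> H \<theta> \<and>
        sat_H \<theta> \<Delta> (blk n) (h(n + 1 := \<beta>, n := x))}"
      by blast
    have sv: "single_valued_set g"
      unfolding single_valued_set_def g_elts using uniq by auto
    have "wf (\<Delta> - Id)" and tot: "total_on (H \<theta>) \<Delta>" and refl: "refl_on (H \<theta>) \<Delta>"
      using wo by (auto simp: order_on_defs well_order_on_def)
    then obtain y where y: "y \<in> {c \<in> H \<theta>. sat_H \<theta> \<Delta> \<phi> (e(i := c))}"
      and min: "\<And>c. (c, y) \<in> \<Delta> - Id \<Longrightarrow> c \<notin> {c \<in> H \<theta>. sat_H \<theta> \<Delta> \<phi> (e(i := c))}"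
      using wfE_min[of "\<Delta> - Id" a "{c \<in> H \<theta>. sat_H \<theta> \<Delta> \<phi> (e(i := c))}"] a by blast
    have "(y, c) \<in> \<Delta>" if "c \<in> H \<theta>" "sat_H \<theta> \<Delta> \<phi> (e(i := c))" for c
    proof -
      have "(c, y) \<notin> \<Delta> - Id" "y \<in> H \<theta>"
        using min[of c] that y by auto
      then show ?thesis
        using that(1) tot refl unfolding total_on_def refl_on_def by (cases "c = y") auto
    qed
    then have "sat_H \<theta> \<Delta> (blk n) (h(n + 1 := \<alpha>, n := y))"
      unfolding blk_n[OF \<alpha>H] using F(3) y by blast
    then have "opair \<alpha> y \<in> elts g"
      unfolding g_elts using \<alpha> y by blast
    then show "\<exists>c\<in>function_values N \<alpha>. sat_H \<theta> \<Delta> \<phi> (e(i := c))"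
      unfolding function_values_def using g sv y by blast
  qed
qed

section \<open>Normal ideals and generic conditions\<close>

definition regressive_function :: "'v::zfc \<Rightarrow> bool" where
  "regressive_function f \<longleftrightarrow> single_valued_set f \<and>
     (\<forall>u\<in>elts f. \<exists>\<beta>\<in>elts omega2. \<exists>\<xi>\<in>elts \<beta>. u = opair \<beta> \<xi>)"

definition constant_on :: "'v::zfc \<Rightarrow> 'v \<Rightarrow> 'v set \<Rightarrow> bool" where
  "constant_on f \<xi> X \<longleftrightarrow> (\<forall>\<alpha>\<in>X. opair \<alpha> \<xi> \<in> elts f)"

definition undefined_on :: "'v::zfc \<Rightarrow> 'v set \<Rightarrow> bool" where
  "undefined_on f X \<longleftrightarrow> (\<forall>\<alpha>\<in>X. \<forall>\<xi>. opair \<alpha> \<xi> \<notin> elts f)"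

definition deciding_conditions :: "'v::zfc set set \<Rightarrow> 'v \<Rightarrow> 'v set" where
  "deciding_conditions J f = {quot_class omega2 J X |X. X \<subseteq> elts omega2 \<and> X \<notin> J \<and>
     (undefined_on f X \<or> (\<exists>\<xi>. constant_on f \<xi> X))}"

text \<open>Unspecified if no representative of d carries a constant value of f. Closure of M under
  it is therefore demanded only for values in omega_2.\<close>

definition decided_value :: "'v::zfc set set \<Rightarrow> 'v \<Rightarrow> 'v \<Rightarrow> 'v" where
  "decided_value J f d =
     (SOME \<xi>. \<exists>X. X \<subseteq> elts omega2 \<and> X \<notin> J \<and> d = quot_class omega2 J X \<and> constant_on f \<xi> X)"

text \<open>The outcome of the genericity argument, phrased without ideal and forcing so that a
  formula over \<open>H \<theta>\<close> can state it.\<close>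

definition good_for :: "'v::zfc set \<Rightarrow> bool" where
  "good_for M \<longleftrightarrow> (\<forall>\<beta>\<in>elts omega2. \<exists>\<alpha>\<in>elts omega2. \<beta> \<in> elts \<alpha> \<and>
     (\<forall>f\<in>M. regressive_function f \<longrightarrow> (\<forall>\<xi>. opair \<alpha> \<xi> \<in> elts f \<longrightarrow> \<xi> \<in> M)))"

context
  fixes J :: "'v::zfc set set"
  assumes normal: "normal_ideal_on omega2 J"
begin

lemma ideal_subset: "X \<in> J \<Longrightarrow> Y \<subseteq> X \<Longrightarrow> Y \<in> J"
  and ideal_Un: "X \<in> J \<Longrightarrow> Y \<in> J \<Longrightarrow> X \<union> Y \<in> J"
  and ideal_empty: "{} \<in> J"
  and ideal_bounded: "\<beta> \<in> elts omega2 \<Longrightarrow> X \<subseteq> elts \<beta> \<Longrightarrow> X \<in> J"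
  and ideal_carrier: "X \<in> J \<Longrightarrow> X \<subseteq> elts omega2"
  using normal unfolding normal_ideal_on_def ideal_on_def by blast+

lemma ideal_diagonal_union:
  "(\<And>\<xi>. \<xi> \<in> elts omega2 \<Longrightarrow> X \<xi> \<in> J) \<Longrightarrow> {\<alpha> \<in> elts omega2. \<exists>\<xi>\<in>elts \<alpha>. \<alpha> \<in> X \<xi>} \<in> J"
  using normal unfolding normal_ideal_on_def by blast

text \<open>Countable completeness from normality: the sets are indexed by elements of omega. At
  points not in omega the diagonal union agrees with the full union, and the points in omega form a
  bounded set.\<close>

lemma ideal_UN_nat:
  assumes X: "\<And>n::nat. X n \<in> J"
  shows "(\<Union>n. X n) \<in> J"
proof -
  obtain h :: "nat \<Rightarrow> 'v" where h: "inj h" "range h \<subseteq> elts omega0"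
    using infinite_countable_subset[OF omega0_spec(2)] by blast
  define Y where "Y \<xi> = (if \<xi> \<in> range h then X (inv h \<xi>) else {})" for \<xi>
  have Yh: "Y (h n) = X n" for n
    using h(1) by (simp add: Y_def)
  have "Y \<xi> \<in> J" for \<xi>
    using X ideal_empty by (simp add: Y_def)
  then have "{\<alpha> \<in> elts omega2. \<exists>\<xi>\<in>elts \<alpha>. \<alpha> \<in> Y \<xi>} \<union> elts omega0 \<in> J"
    using ideal_diagonal_union[of Y] ideal_bounded[OF omega_facts(5)] ideal_Un by blast
  moreover have "(\<Union>n. X n) \<subseteq> {\<alpha> \<in> elts omega2. \<exists>\<xi>\<in>elts \<alpha>. \<alpha> \<in> Y \<xi>} \<union> elts omega0"
  proof
    fix \<alpha> assume "\<alpha> \<in> (\<Union>n. X n)"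
    then obtain n where n: "\<alpha> \<in> X n"
      by blast
    then have \<alpha>: "\<alpha> \<in> elts omega2" "\<alpha> \<in> Y (h n)"
      using ideal_carrier[OF X] Yh by auto
    show "\<alpha> \<in> {\<alpha> \<in> elts omega2. \<exists>\<xi>\<in>elts \<alpha>. \<alpha> \<in> Y \<xi>} \<union> elts omega0"
    proof (cases "\<alpha> \<in> elts omega0")
      case False
      have "Ord \<alpha>"
        using \<alpha>(1) Ord_mem omega_facts(2) by blast
      then have "elts omega0 \<subseteq> elts \<alpha>"
        using False Ord_linear[OF _ omega0_spec(1)] Ord_trans by blast
      then show ?thesis
        using h(2) \<alpha> by blast
    qed simp
  qed
  ultimately show ?thesis
    by (rule ideal_subset)
qed

lemma ideal_UN_countable:
  assumes "countable A" "\<And>a. a \<in> A \<Longrightarrow> X a \<in> J"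
  shows "(\<Union>a\<in>A. X a) \<in> J"
proof (cases "A = {}")
  case False
  have "(\<Union>a\<in>A. X a) = (\<Union>n. X (from_nat_into A n))"
    by (subst range_from_nat_into[OF False assms(1), symmetric]) simp
  then show ?thesis
    using ideal_UN_nat[of "\<lambda>n. X (from_nat_into A n)"] assms(2) from_nat_into[OF False] by simp
qed (simp add: ideal_empty)

section \<open>The quotient order, its deciding conditions and genericity\<close>

lemma vset_inj_on_Pow: "inj_on vset (Pow (elts x))"
  by (rule inj_onI) (metis PowD elts_vset small_elts small_subset)

lemma quot_class_eq_iff:
  assumes "X \<subseteq> elts omega2" "Y \<subseteq> elts omega2"
  shows "quot_class omega2 J X = quot_class omega2 J Y \<longleftrightarrow> sym_diff X Y \<in> J"
proof -
  define C where "C X = {Z. Z \<subseteq> elts omega2 \<and> sym_diff X Z \<in> J}" for X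
  have C_Pow: "C X \<subseteq> Pow (elts omega2)" for X
    by (auto simp: C_def)
  have sm: "small (vset ` C X)" for X
    using small_subset[OF small_vset_Pow] C_Pow by (metis image_mono)
  have "quot_class omega2 J X = quot_class omega2 J Y \<longleftrightarrow> vset ` C X = vset ` C Y"
    unfolding quot_class_def C_def[symmetric] using elts_vset[OF sm] by metis
  also have "\<dots> \<longleftrightarrow> C X = C Y"
    by (rule inj_on_image_eq_iff[OF vset_inj_on_Pow C_Pow C_Pow])
  also have "\<dots> \<longleftrightarrow> sym_diff X Y \<in> J"
  proof
    assume "C X = C Y"
    moreover have "Y \<in> C Y"
      using assms(2) ideal_empty by (simp add: C_def)
    ultimately show "sym_diff X Y \<in> J"
      by (auto simp: C_def)
  next
    assume XY: "sym_diff X Y \<in> J"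
    have "sym_diff X Z \<in> J \<longleftrightarrow> sym_diff Y Z \<in> J" for Z
    proof
      assume "sym_diff X Z \<in> J"
      then show "sym_diff Y Z \<in> J"
        by (rule ideal_subset[OF ideal_Un[OF XY]]) blast
    next
      assume "sym_diff Y Z \<in> J"
      then show "sym_diff X Z \<in> J"
        by (rule ideal_subset[OF ideal_Un[OF XY]]) blast
    qed
    then show "C X = C Y"
      by (simp add: C_def)
  qed
  finally show ?thesis .
qed

lemma quot_carrier_iff:
  "X \<subseteq> elts omega2 \<Longrightarrow> quot_class omega2 J X \<in> quot_carrier omega2 J \<longleftrightarrow> X \<notin> J"
  using quot_class_eq_iff[of X "{}"] by (auto simp: quot_carrier_def)

lemma quot_carrierE:
  assumes "p \<in> quot_carrier omega2 J"
  obtains X where "X \<subseteq> elts omega2" "X \<notin> J" "p = quot_class omega2 J X"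
  using assms quot_carrier_iff unfolding quot_carrier_def by blast

text \<open>\<open>quot_le\<close> asks only for some representatives; other ones change the
  difference X - Y by a set in J.\<close>

lemma quot_le_iff:
  assumes "X \<subseteq> elts omega2" "Y \<subseteq> elts omega2"
  shows "(quot_class omega2 J X, quot_class omega2 J Y) \<in> quot_le omega2 J \<longleftrightarrow>
    X \<notin> J \<and> Y \<notin> J \<and> X - Y \<in> J"
proof
  assume "(quot_class omega2 J X, quot_class omega2 J Y) \<in> quot_le omega2 J"
  then obtain X' Y' where pos: "X \<notin> J" "Y \<notin> J"
    and X'Y': "X' \<subseteq> elts omega2" "Y' \<subseteq> elts omega2" "X' - Y' \<in> J"
    and eq: "quot_class omega2 J X = quot_class omega2 J X'"
      "quot_class omega2 J Y = quot_class omega2 J Y'"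
    using quot_carrier_iff assms unfolding quot_le_def by auto
  have "sym_diff X X' \<in> J" "sym_diff Y Y' \<in> J"
    using eq quot_class_eq_iff assms X'Y' by simp_all
  then have "sym_diff X X' \<union> sym_diff Y Y' \<union> (X' - Y') \<in> J"
    using X'Y'(3) ideal_Un by blast
  then have "X - Y \<in> J"
    by (rule ideal_subset) blast
  then show "X \<notin> J \<and> Y \<notin> J \<and> X - Y \<in> J"
    using pos by blast
next
  assume "X \<notin> J \<and> Y \<notin> J \<and> X - Y \<in> J"
  then show "(quot_class omega2 J X, quot_class omega2 J Y) \<in> quot_le omega2 J"
    using quot_carrier_iff assms unfolding quot_le_def by blast
qed

lemma small_quot_carrier: "small (quot_carrier omega2 J)"
proof -
  have "quot_carrier omega2 J \<subseteq> (\<lambda>x. quot_class omega2 J (elts x)) ` vset ` Pow (elts omega2)"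
  proof
    fix p assume "p \<in> quot_carrier omega2 J"
    then obtain X where "X \<subseteq> elts omega2" "p = quot_class omega2 J X"
      by (elim quot_carrierE)
    then show "p \<in> (\<lambda>x. quot_class omega2 J (elts x)) ` vset ` Pow (elts omega2)"
      using elts_vset[OF small_subset[OF small_elts]] by (metis PowI image_eqI)
  qed
  then show ?thesis
    using small_subset small_image small_vset_Pow by blast
qed

lemma deciding_conditions_subset: "deciding_conditions J f \<subseteq> quot_carrier omega2 J"
  unfolding deciding_conditions_def using quot_carrier_iff by blast

text \<open>A form of Fodor's lemma: as f is regressive, S is covered by the part U where f is
  undefined and the diagonal union of the fibres \<open>V \<xi>\<close>. Since S is positive, U or
  some fibre is positive.\<close>

lemma deciding_conditions_dense:
  assumes f: "regressive_function f"
  shows "dense_in (quot_carrier omega2 J) (quot_le omega2 J) (deciding_conditions J f)"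
  unfolding dense_in_def
proof (intro conjI ballI)
  fix p assume "p \<in> quot_carrier omega2 J"
  then obtain S where S: "S \<subseteq> elts omega2" "S \<notin> J" "p = quot_class omega2 J S"
    by (rule quot_carrierE)
  have sub: "\<exists>d\<in>deciding_conditions J f. (d, p) \<in> quot_le omega2 J"
    if "T \<subseteq> S" "T \<notin> J" "undefined_on f T \<or> (\<exists>\<xi>. constant_on f \<xi> T)" for T
  proof -
    have T: "T \<subseteq> elts omega2"
      using that S by blast
    have "T - S \<in> J"
      using that(1) ideal_empty by (simp add: Diff_eq_empty_iff[THEN iffD2])
    then have "(quot_class omega2 J T, p) \<in> quot_le omega2 J"
      unfolding S(3) quot_le_iff[OF T S(1)] using that S by simp
    then show ?thesis
      unfolding deciding_conditions_def using that T by blast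
  qed
  define U where "U = {\<alpha> \<in> S. \<forall>\<xi>. opair \<alpha> \<xi> \<notin> elts f}"
  define V where "V \<xi> = {\<alpha> \<in> S. opair \<alpha> \<xi> \<in> elts f}" for \<xi>
  show "\<exists>d\<in>deciding_conditions J f. (d, p) \<in> quot_le omega2 J"
  proof (cases "U \<in> J \<and> (\<forall>\<xi>. V \<xi> \<in> J)")
    case True
    then have "{\<alpha> \<in> elts omega2. \<exists>\<xi>\<in>elts \<alpha>. \<alpha> \<in> V \<xi>} \<in> J"
      using ideal_diagonal_union by blast
    then have "U \<union> {\<alpha> \<in> elts omega2. \<exists>\<xi>\<in>elts \<alpha>. \<alpha> \<in> V \<xi>} \<in> J"
      using True ideal_Un by blast
    moreover have "S \<subseteq> U \<union> {\<alpha> \<in> elts omega2. \<exists>\<xi>\<in>elts \<alpha>. \<alpha> \<in> V \<xi>}"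
    proof
      fix \<alpha> assume \<alpha>: "\<alpha> \<in> S"
      show "\<alpha> \<in> U \<union> {\<alpha> \<in> elts omega2. \<exists>\<xi>\<in>elts \<alpha>. \<alpha> \<in> V \<xi>}"
      proof (cases "\<alpha> \<in> U")
        case False
        then obtain \<xi> where \<xi>: "opair \<alpha> \<xi> \<in> elts f"
          using \<alpha> by (auto simp: U_def)
        then have "\<xi> \<in> elts \<alpha>"
          using f unfolding regressive_function_def by fastforce
        then show ?thesis
          using \<xi> \<alpha> S(1) by (auto simp: V_def)
      qed simp
    qed
    ultimately show ?thesis
      using S(2) ideal_subset by blast
  next
    case False
    then show ?thesis
      using sub[of U] sub[of "V _"] unfolding undefined_on_def constant_on_def U_def V_def
      by blast
  qed
qed (rule deciding_conditions_subset)

text \<open>If the exceptional part of Q were positive, predensity would make its class compatible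
  with some d in M. But d has a representative X without exceptional points, so a common extension
  would be represented by a set in J.\<close>

lemma generic_condition_decides:
  assumes gen: "generic_condition (quot_carrier omega2 J) (quot_le omega2 J) M q"
    and q: "q = quot_class omega2 J Q" and Q: "Q \<subseteq> elts omega2"
    and f: "regressive_function f" "vset (deciding_conditions J f) \<in> M"
    and val: "\<And>d. d \<in> deciding_conditions J f \<inter> M \<Longrightarrow>
      decided_value J f d \<in> elts omega2 \<Longrightarrow> decided_value J f d \<in> M"
  shows "Q - {\<alpha>. \<forall>\<xi>. opair \<alpha> \<xi> \<in> elts f \<longrightarrow> \<xi> \<in> M} \<in> J"
proof (rule ccontr)
  let ?A = "{\<alpha>. \<forall>\<xi>. opair \<alpha> \<xi> \<in> elts f \<longrightarrow> \<xi> \<in> M}"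
  assume pos: "Q - ?A \<notin> J"
  have QA: "Q - ?A \<subseteq> elts omega2"
    using Q by blast
  have "Q \<notin> J"
    using pos ideal_subset by blast
  then have le: "(quot_class omega2 J (Q - ?A), q) \<in> quot_le omega2 J"
    unfolding q quot_le_iff[OF QA Q] using pos ideal_empty by (simp add: Diff_eq)
  have elts_D: "elts (vset (deciding_conditions J f)) = deciding_conditions J f"
    using small_subset[OF small_quot_carrier deciding_conditions_subset] by simp
  then have "predense_below (quot_carrier omega2 J) (quot_le omega2 J) (deciding_conditions J f \<inter> M) q"
    using gen f(2) deciding_conditions_dense[OF f(1)] unfolding generic_condition_def by metis
  then obtain d s where d: "d \<in> deciding_conditions J f" "d \<in> M"
    and s: "s \<in> quot_carrier omega2 J" "(s, quot_class omega2 J (Q - ?A)) \<in> quot_le omega2 J"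
      "(s, d) \<in> quot_le omega2 J"
    using le quot_carrier_iff[OF QA] pos unfolding predense_below_def by blast
  obtain X where X: "X \<subseteq> elts omega2" "X \<notin> J" "d = quot_class omega2 J X" "X \<subseteq> ?A"
  proof (cases "\<exists>\<xi> X. X \<subseteq> elts omega2 \<and> X \<notin> J \<and> d = quot_class omega2 J X \<and> constant_on f \<xi> X")
    case True
    then obtain X where X: "X \<subseteq> elts omega2" "X \<notin> J" "d = quot_class omega2 J X"
      "constant_on f (decided_value J f d) X"
      using someI_ex[OF True] unfolding decided_value_def by blast
    \<comment> \<open>A point of X shows that the constant value is below omega_2, as
      \<open>val\<close> requires.\<close>
    obtain \<alpha> where "\<alpha> \<in> X"
      using X(2) ideal_empty by (cases "X = {}") auto
    then have "opair \<alpha> (decided_value J f d) \<in> elts f"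
      using X(4) unfolding constant_on_def by blast
    then have "decided_value J f d \<in> elts omega2"
      using f(1) Ord_trans[OF omega_facts(2)] unfolding regressive_function_def by fastforce
    then have "decided_value J f d \<in> M"
      using val d by blast
    then have "X \<subseteq> ?A"
      using X(4) f(1) unfolding constant_on_def regressive_function_def single_valued_set_def
      by blast
    then show ?thesis
      using that X by blast
  next
    case False
    then obtain X where "X \<subseteq> elts omega2" "X \<notin> J" "d = quot_class omega2 J X" "undefined_on f X"
      using d(1) unfolding deciding_conditions_def by blast
    then show ?thesis
      using that unfolding undefined_on_def by blast
  qed
  obtain S where S: "S \<subseteq> elts omega2" "S \<notin> J" "s = quot_class omega2 J S"
    using s(1) by (rule quot_carrierE)
  have "S - (Q - ?A) \<in> J" "S - X \<in> J"
    using s(2,3) S X QA quot_le_iff by auto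
  then have "(S - (Q - ?A)) \<union> (S - X) \<in> J"
    by (rule ideal_Un)
  then have "S \<in> J"
    by (rule ideal_subset) (use X(4) in blast)
  then show False
    using S(2) by blast
qed

text \<open>Countably many exceptional sets and one bounded set together lie in J, so they cannot
  cover the positive set Q.\<close>

lemma generic_condition_good_for:
  assumes M: "countable M" and gen: "generic_condition (quot_carrier omega2 J) (quot_le omega2 J) M q"
    and D: "\<And>f. f \<in> M \<Longrightarrow> regressive_function f \<Longrightarrow> vset (deciding_conditions J f) \<in> M"
    and val: "\<And>f d. f \<in> M \<Longrightarrow> d \<in> M \<Longrightarrow> d \<in> deciding_conditions J f \<Longrightarrow>
      decided_value J f d \<in> elts omega2 \<Longrightarrow> decided_value J f d \<in> M"
  shows "good_for M"
  unfolding good_for_def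
proof (rule ballI, rule ccontr)
  fix \<beta> :: 'v assume \<beta>: "\<beta> \<in> elts omega2"
  let ?A = "\<lambda>f. {\<alpha>. \<forall>\<xi>. opair \<alpha> \<xi> \<in> elts f \<longrightarrow> \<xi> \<in> M}"
  let ?R = "{f \<in> M. regressive_function f}"
  assume neg: "\<not> (\<exists>\<alpha>\<in>elts omega2. \<beta> \<in> elts \<alpha> \<and>
     (\<forall>f\<in>M. regressive_function f \<longrightarrow> (\<forall>\<xi>. opair \<alpha> \<xi> \<in> elts f \<longrightarrow> \<xi> \<in> M)))"
  have "q \<in> quot_carrier omega2 J"
    using gen unfolding generic_condition_def by blast
  then obtain Q where Q: "Q \<subseteq> elts omega2" "Q \<notin> J" "q = quot_class omega2 J Q"
    by (rule quot_carrierE)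
  have "Q - ?A f \<in> J" if "f \<in> ?R" for f
    by (rule generic_condition_decides[OF gen Q(3,1)]) (use that D val in auto)
  moreover have "countable ?R"
    using M countable_subset by (metis (no_types, lifting) mem_Collect_eq subsetI)
  ultimately have UN: "(\<Union>f\<in>?R. Q - ?A f) \<in> J"
    by (intro ideal_UN_countable)
  \<comment> \<open>\<gamma> lies strictly above \<beta>, so that the bounded set
    \<open>elts \<gamma>\<close> takes in \<beta> itself along with everything below it.\<close>
  have "infinite (elts (omega1 :: 'v))"
    using omega_facts(1,3) Ord_trans omega0_spec(2) finite_subset by blast
  then obtain \<gamma> where \<gamma>: "\<gamma> \<in> elts omega2" "\<beta> \<in> elts \<gamma>"
    using card_succ_limit[of omega1 \<beta>] \<beta> unfolding omega2_def by blast
  have "Q \<subseteq> (\<Union>f\<in>?R. Q - ?A f) \<union> elts \<gamma>"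
  proof
    fix \<alpha> assume \<alpha>: "\<alpha> \<in> Q"
    show "\<alpha> \<in> (\<Union>f\<in>?R. Q - ?A f) \<union> elts \<gamma>"
    proof (cases "\<beta> \<in> elts \<alpha>")
      case True
      then show ?thesis
        using neg \<alpha> Q(1) by blast
    next
      case False
      have ords: "Ord \<alpha>" "Ord \<beta>" "Ord \<gamma>"
        using \<alpha> Q(1) \<beta> \<gamma>(1) Ord_mem[OF omega_facts(2)] by blast+
      then have "\<alpha> \<in> elts \<beta> \<or> \<alpha> = \<beta>"
        using False Ord_linear by blast
      then show ?thesis
        using \<gamma>(2) ords Ord_trans by blast
    qed
  qed
  moreover have "(\<Union>f\<in>?R. Q - ?A f) \<union> elts \<gamma> \<in> J"
    using UN ideal_bounded[OF \<gamma>(1)] ideal_Un by blast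
  ultimately show False
    using Q(2) ideal_subset by blast
qed

end

section \<open>Coding Skolem functions by a set\<close>

definition opair_closed :: "'v::zfc set \<Rightarrow> bool" where
  "opair_closed M \<longleftrightarrow> (\<forall>x\<in>M. \<forall>y\<in>M. opair x y \<in> M)"

definition closed_under :: "'v::zfc \<Rightarrow> 'v set \<Rightarrow> bool" where
  "closed_under c M \<longleftrightarrow> (\<forall>x\<in>M. \<forall>y. opair x y \<in> elts c \<longrightarrow> y \<in> M)"

fun list_code :: "'v::zfc \<Rightarrow> 'v list \<Rightarrow> 'v" where
  "list_code p [] = p"
| "list_code p (x # xs) = opair x (list_code p xs)"

lemma list_code_inject:
  assumes "\<And>x y. opair x y \<noteq> p"
  shows "list_code p xs = list_code p ys \<longleftrightarrow> xs = ys"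
proof (induction xs arbitrary: ys)
  case Nil
  then show ?case
    using assms by (cases ys) (auto simp: eq_commute[of p])
next
  case (Cons x xs)
  then show ?case
    using assms by (cases ys) auto
qed

lemma opair_neq_omega0: "opair x y \<noteq> omega0"
proof
  assume "opair x y = omega0"
  then have "finite (elts (omega0 :: 'a))"
    by (metis elts_opair finite.emptyI finite_insert)
  then show False
    using omega0_spec(2) by blast
qed

text \<open>On K the graph of U is a set, without any claim that A is one.\<close>

lemma small_closure:
  fixes X :: "'v::zfc set" and U :: "'v \<Rightarrow> 'v"
  assumes X: "small X" "X \<subseteq> A" and A: "opair_closed A" "U ` A \<subseteq> A"
  shows "\<exists>K. small K \<and> X \<subseteq> K \<and> K \<subseteq> A \<and> opair_closed K \<and> U ` K \<subseteq> K"
proof -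
  define K where "K = rec_nat X (\<lambda>_ K. K \<union> U ` K \<union> (\<Union>x\<in>K. opair x ` K))"
  have K_simps: "K 0 = X" "K (Suc n) = K n \<union> U ` K n \<union> (\<Union>x\<in>K n. opair x ` K n)" for n
    by (simp_all add: K_def)
  have "small (K n)" for n
    by (induction n) (auto simp: K_simps X(1) intro!: small_Un small_image small_Union)
  then have "small (\<Union>n. K n)"
    by (rule small_UN_nat)
  moreover have "X \<subseteq> (\<Union>n. K n)"
    using UN_upper[of 0 UNIV K] by (simp add: K_simps)
  moreover have "K n \<subseteq> A" for n
  proof (induction n)
    case (Suc n)
    then have "U ` K n \<subseteq> A" "(\<Union>x\<in>K n. opair x ` K n) \<subseteq> A"
      using A unfolding opair_closed_def by blast+
    then show ?case
      using Suc by (simp add: K_simps)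
  qed (simp add: K_simps X(2))
  moreover have "opair_closed (\<Union>n. K n)"
    unfolding opair_closed_def
  proof safe
    fix x y m n assume "x \<in> K m" "y \<in> K n"
    moreover have "m \<le> n \<Longrightarrow> K m \<subseteq> K n" for m n
      by (rule lift_Suc_mono_le[of K]) (auto simp: K_simps)
    ultimately have "x \<in> K (max m n)" "y \<in> K (max m n)"
      by (meson max.cobounded1 max.cobounded2 subsetD)+
    then have "opair x y \<in> K (Suc (max m n))"
      unfolding K_simps by blast
    then show "opair x y \<in> (\<Union>n. K n)"
      by blast
  qed
  moreover have "U ` (\<Union>n. K n) \<subseteq> (\<Union>n. K n)"
  proof safe
    fix x n assume "x \<in> K n"
    then have "U x \<in> K (Suc n)"
      unfolding K_simps by blast
    then show "U x \<in> (\<Union>n. K n)"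
      by blast
  qed
  ultimately show ?thesis
    by blast
qed

text \<open>
  The index and the arguments of an operation are coded by iterated pairs over \<open>\<omega>\<close>, which is not
  itself a pair, so that one unary function on codes represents all operations at once.
\<close>

lemma code_operations:
  fixes \<Phi> :: "nat \<Rightarrow> 'v::zfc list \<Rightarrow> 'v"
  assumes A: "opair_closed A" "omega0 \<in> A" and X: "small X" "X \<subseteq> A"
  obtains c K where "single_valued_set c" "X \<subseteq> K" "K \<subseteq> A" "omega0 \<in> K"
    "\<And>M n xs. omega0 \<in> M \<Longrightarrow> opair_closed M \<Longrightarrow> closed_under c M \<Longrightarrow>
      set xs \<subseteq> M \<inter> K \<Longrightarrow> \<Phi> n xs \<in> A \<Longrightarrow> \<Phi> n xs \<in> M \<inter> K"
proof -
  let ?p = "omega0 :: 'v"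
  \<comment> \<open>The index n becomes a list of n copies of omega, so that codes are built from
    the arguments by omega and pairing alone.\<close>
  define code where "code = (\<lambda>(n, xs). opair (list_code ?p (replicate n ?p)) (list_code ?p xs))"
  have inj: "inj code"
    by (rule injI) (auto simp: code_def list_code_inject[OF opair_neq_omega0] replicate_eq_replicate)
  \<comment> \<open>Arguments that are not codes, and results outside A, are sent to omega so that U
    maps A into itself.\<close>
  define U where "U x = (if x \<in> range code \<and> case_prod \<Phi> (inv code x) \<in> A
      then case_prod \<Phi> (inv code x) else ?p)" for x
  have U_code: "U (code (n, xs)) = \<Phi> n xs" if "\<Phi> n xs \<in> A" for n xs
    using that inj by (simp add: U_def)
  have "U ` A \<subseteq> A"
    using A(2) by (auto simp: U_def)
  moreover have "small (insert ?p X)" "insert ?p X \<subseteq> A"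
    using X A(2) by (auto intro: small_insert)
  ultimately obtain K where K: "small K" "insert ?p X \<subseteq> K" "K \<subseteq> A" "opair_closed K" "U ` K \<subseteq> K"
    using small_closure[OF _ _ A(1)] by metis
  define c where "c = vset ((\<lambda>x. opair x (U x)) ` K)"
  have c: "opair x y \<in> elts c \<longleftrightarrow> x \<in> K \<and> y = U x" for x y
    using K(1) by (auto simp: c_def small_image)
  have codes: "code (n, xs) \<in> B" if "?p \<in> B" "opair_closed B" "set xs \<subseteq> B" for n xs B
  proof -
    have "list_code ?p ys \<in> B" if "set ys \<subseteq> B" for ys
      using that by (induction ys) (use \<open>?p \<in> B\<close> \<open>opair_closed B\<close> in \<open>auto simp: opair_closed_def\<close>)
    moreover have "set (replicate n ?p) \<subseteq> B"
      using that(1) by auto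
    ultimately show ?thesis
      using that(2,3) by (simp add: code_def opair_closed_def)
  qed
  have "\<Phi> n xs \<in> M \<inter> K"
    if M: "?p \<in> M" "opair_closed M" "closed_under c M" "set xs \<subseteq> M \<inter> K" "\<Phi> n xs \<in> A" for M n xs
  proof -
    \<comment> \<open>Closure under c carries the value into M, closure under U carries it into
      K.\<close>
    have "code (n, xs) \<in> M" "code (n, xs) \<in> K"
      using codes[of M] codes[of K] M K(2,4) by simp_all
    then show ?thesis
      using U_code[OF M(5)] M(3) K(5) c unfolding closed_under_def by fastforce
  qed
  moreover have "single_valued_set c"
    unfolding single_valued_set_def using c by simp
  ultimately show ?thesis
    using K(2,3) by (intro that[of c K]) auto
qed

text \<open>Numbers the formulas, so that Skolem functions can be indexed by natural
  numbers.\<close>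

instance fm :: (countable) countable
  by countable_datatype

text \<open>A common bound T lets all regressive functions belong to one \<open>H \<chi>\<close>,
  and then to the set K of coded arguments.\<close>

lemma regressive_functions_bounded: "\<exists>T. \<forall>f::'v::zfc. regressive_function f \<longrightarrow> elts f \<subseteq> elts T"
proof -
  let ?T = "\<Union>\<beta>\<in>elts (omega2 :: 'v). opair \<beta> ` elts \<beta>"
  have "small ?T"
    by (intro small_Union small_image small_elts)
  then show ?thesis
    unfolding regressive_function_def by (intro exI[of _ "vset ?T"]) fastforce
qed

text \<open>
  An arbitrary \<open>N\<close> need not contain the ideal, and properness is awkward to state inside
  \<open>H\<^sub>\<theta>\<close>. The existence of a set with the following property is a first-order consequence of
  properness that mentions neither the ideal nor elementarity, so such a set can be found in \<open>N\<close>.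
\<close>

definition guides :: "'v::zfc \<Rightarrow> bool" where
  "guides c \<longleftrightarrow> single_valued_set c \<and> (\<forall>M. countable M \<and> omega0 \<in> M \<and> opair_closed M \<and>
     closed_under c M \<longrightarrow> good_for M)"

text \<open>M may have elements outside \<open>H \<chi>\<close>, so M \<inter> K is taken as the
  elementary submodel. K contains all regressive functions; hence M and M \<inter> K have the same
  ones, and \<open>good_for\<close> passes back to M.\<close>

lemma guides_exists:
  fixes J :: "'v::zfc set set"
  assumes normal: "normal_ideal_on omega2 J"
    and \<chi>: "regular \<chi>" and o: "omega2 \<in> H \<chi>" and P: "vset (quot_carrier omega2 J) \<in> H \<chi>"
    and code: "forcing_code (quot_carrier omega2 J) (quot_le omega2 J) \<in> H \<chi>"
    and T: "T \<in> H \<chi>" "\<And>f::'v. regressive_function f \<Longrightarrow> elts f \<subseteq> elts T"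
    and p0: "p0 \<in> quot_carrier omega2 J"
    and proper: "\<And>M p. countable M \<Longrightarrow> elem_sub_H M \<chi> \<Longrightarrow>
      forcing_code (quot_carrier omega2 J) (quot_le omega2 J) \<in> M \<Longrightarrow>
      p \<in> quot_carrier omega2 J \<inter> M \<Longrightarrow>
      \<exists>q. generic_condition (quot_carrier omega2 J) (quot_le omega2 J) M q"
  shows "\<exists>c :: 'v. guides c"
proof -
  let ?P = "quot_carrier omega2 J" and ?R = "quot_le omega2 J"
  let ?I = "\<lambda>_::unit. \<lambda>x y::'v. x \<in> elts y"
  \<comment> \<open>A list supplies the values of the first variables, and omega fills the remaining
    ones.\<close>
  define skolem :: "nat \<Rightarrow> 'v list \<Rightarrow> 'v" where
    "skolem k xs = (let (\<phi> :: unit fm, i) = from_nat k;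
        e = (\<lambda>j. if j < length xs then xs ! j else omega0)
      in SOME b. b \<in> H \<chi> \<and> sat ?I (H \<chi>) \<phi> (e(i := b)))" for k xs
  \<comment> \<open>The constant p0 ensures that the submodel contains a condition, since properness
    provides generic conditions only below such conditions.\<close>
  define \<Phi> where "\<Phi> n xs =
    (if n = 0 then vset (deciding_conditions J (hd xs))
     else if n = 1 then decided_value J (hd xs) (hd (tl xs))
     else if n = 2 then forcing_code ?P ?R
     else if n = 3 then p0
     else skolem (n - 4) xs)" for n xs
  let ?X = "{f :: 'v. regressive_function f}"
  have XT: "?X \<subseteq> vset ` Pow (elts T)"
  proof
    fix f assume "f \<in> ?X"
    then show "f \<in> vset ` Pow (elts T)"
      using T(2) by (intro image_eqI[of f vset "elts f"]) auto
  qed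
  have X: "small ?X" "?X \<subseteq> H \<chi>"
    using small_subset[OF small_vset_Pow XT] H_subset[OF T(1)] T(2) by auto
  have elts_P: "elts (vset ?P) = ?P"
    using small_quot_carrier[OF normal] by simp
  have omega2_H: "\<xi> \<in> H \<chi>" if "\<xi> \<in> elts omega2" for \<xi>
    using H_trans[OF o that] .
  have closed: "opair_closed (H \<chi>)"
    using H_opair[OF \<chi>] by (simp add: opair_closed_def)
  obtain c K where sv: "single_valued_set c" and K: "?X \<subseteq> K" "K \<subseteq> H \<chi>" "omega0 \<in> K"
    and op: "\<And>M n xs. omega0 \<in> M \<Longrightarrow> opair_closed M \<Longrightarrow> closed_under c M \<Longrightarrow>
      set xs \<subseteq> M \<inter> K \<Longrightarrow> \<Phi> n xs \<in> H \<chi> \<Longrightarrow> \<Phi> n xs \<in> M \<inter> K"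
    by (rule code_operations[OF closed omega2_H[OF omega_facts(5)] X, of \<Phi>]) blast
  have "good_for M" if M: "countable M" "omega0 \<in> M" "opair_closed M" "closed_under c M" for M
  proof -
    define M0 where "M0 = M \<inter> K"
    have M0: "\<Phi> n xs \<in> M0" if "set xs \<subseteq> M0" "\<Phi> n xs \<in> H \<chi>" for n xs
      using op[OF M(2-4)] that unfolding M0_def by blast
    have "elem_sub ?I M0 (H \<chi>)"
    proof (rule Tarski_Vaught)
      show "M0 \<noteq> {}" "M0 \<subseteq> H \<chi>"
        using M(2) K by (auto simp: M0_def)
      fix \<phi> :: "unit fm" and i e a
      assume e: "range e \<subseteq> M0" and a: "a \<in> H \<chi>" "sat ?I (H \<chi>) \<phi> (e(i := a))"
      \<comment> \<open>Only the variables below \<open>var_bound \<phi>\<close> matter, so a finite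
        list carries the assignment.\<close>
      define xs where "xs = map e [0..<var_bound \<phi>]"
      define e' where "e' j = (if j < length xs then xs ! j else omega0)" for j
      have sat_e': "sat ?I (H \<chi>) \<phi> (e'(i := b)) \<longleftrightarrow> sat ?I (H \<chi>) \<phi> (e(i := b))" for b
        by (rule sat_cong) (simp add: e'_def xs_def)
      define b where "b = (SOME b. b \<in> H \<chi> \<and> sat ?I (H \<chi>) \<phi> (e'(i := b)))"
      have b: "b \<in> H \<chi> \<and> sat ?I (H \<chi>) \<phi> (e'(i := b))"
        unfolding b_def by (rule someI[of _ a]) (use a sat_e' in blast)
      have "\<Phi> (to_nat (\<phi>, i) + 4) xs = b"
        by (simp add: \<Phi>_def skolem_def b_def e'_def[abs_def])
      moreover have "set xs \<subseteq> M0"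
        using e by (auto simp: xs_def)
      ultimately have "b \<in> M0"
        using M0 b by metis
      then show "\<exists>b\<in>M0. sat ?I (H \<chi>) \<phi> (e(i := b))"
        using b sat_e' by blast
    qed
    then have "elem_sub_H M0 \<chi>"
      by (simp add: elem_sub_H_def)
    moreover have "countable M0"
      using M(1) by (simp add: M0_def)
    moreover have "forcing_code ?P ?R \<in> M0"
      using M0[of "[]" 2] code by (simp add: \<Phi>_def)
    moreover have "p0 \<in> ?P \<inter> M0"
      using M0[of "[]" 3] p0 H_trans[OF P, unfolded elts_P] by (simp add: \<Phi>_def)
    ultimately obtain q where q: "generic_condition ?P ?R M0 q"
      using proper by blast
    have "good_for M0"
    proof (rule generic_condition_good_for[OF normal \<open>countable M0\<close> q])
      fix f assume "f \<in> M0"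
      moreover have "vset (deciding_conditions J f) \<in> H \<chi>"
        using small_subset[OF small_quot_carrier[OF normal] deciding_conditions_subset[OF normal]]
          deciding_conditions_subset[OF normal] elts_P by (intro H_subset[OF P]) simp
      ultimately show "vset (deciding_conditions J f) \<in> M0"
        using M0[of "[f]" 0] by (simp add: \<Phi>_def)
    next
      fix f d assume "f \<in> M0" "d \<in> M0" "decided_value J f d \<in> elts omega2"
      then show "decided_value J f d \<in> M0"
        using M0[of "[f, d]" 1] omega2_H by (simp add: \<Phi>_def)
    qed
    then show "good_for M"
      using K(1) unfolding good_for_def M0_def by blast
  qed
  then show ?thesis
    using sv unfolding guides_def by blast
qed

section \<open>Guides as a first-order property\<close>

definition fm_single_valued :: "nat \<Rightarrow> nat \<Rightarrow> mem_ord_sym fm" where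
  "fm_single_valued f s = FAll s (FAll (s + 1) (FAll (s + 2) (FImp (fm_opair_mem f s (s + 1) (s + 3))
     (FImp (fm_opair_mem f s (s + 2) (s + 3)) (Eq (s + 1) (s + 2))))))"

definition fm_regressive :: "nat \<Rightarrow> nat \<Rightarrow> nat \<Rightarrow> mem_ord_sym fm" where
  "fm_regressive o2 f s = Conj (fm_single_valued f s) (FAll s (FImp (FMem s f)
     (Ex (s + 1) (Conj (FMem (s + 1) o2) (Ex (s + 2) (Conj (FMem (s + 2) (s + 1))
       (fm_opair s (s + 1) (s + 2) (s + 3))))))))"

definition fm_good_for :: "nat \<Rightarrow> nat \<Rightarrow> nat \<Rightarrow> mem_ord_sym fm" where
  "fm_good_for o2 m s = FAll s (FImp (FMem s o2) (Ex (s + 1) (Conj (FMem (s + 1) o2)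
     (Conj (FMem s (s + 1)) (FAll (s + 2) (FImp (FMem (s + 2) m)
       (FImp (fm_regressive o2 (s + 2) (s + 3)) (FAll (s + 3)
         (FImp (fm_opair_mem (s + 2) (s + 1) (s + 3) (s + 4)) (FMem (s + 3) m))))))))))"

definition fm_opair_closed :: "nat \<Rightarrow> nat \<Rightarrow> mem_ord_sym fm" where
  "fm_opair_closed m s = FAll s (FImp (FMem s m) (FAll (s + 1) (FImp (FMem (s + 1) m)
     (fm_opair_mem m s (s + 1) (s + 2)))))"

definition fm_closed_under :: "nat \<Rightarrow> nat \<Rightarrow> nat \<Rightarrow> mem_ord_sym fm" where
  "fm_closed_under c m s = FAll s (FImp (FMem s m) (FAll (s + 1)
     (FImp (fm_opair_mem c s (s + 1) (s + 2)) (FMem (s + 1) m))))"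

definition fm_guides :: "nat \<Rightarrow> nat \<Rightarrow> nat \<Rightarrow> nat \<Rightarrow> mem_ord_sym fm" where
  "fm_guides o2 o0 c s = Conj (fm_single_valued c s) (FAll s (FImp (fm_lepoll s o0 (s + 1))
     (FImp (FMem o0 s) (FImp (fm_opair_closed s (s + 1)) (FImp (fm_closed_under c s (s + 1))
       (fm_good_for o2 s (s + 1)))))))"

lemma sat_fm_single_valued:
  assumes "regular \<theta>" "f < s" "e f \<in> H \<theta>"
  shows "sat_H \<theta> \<Delta> (fm_single_valued f s) e \<longleftrightarrow> single_valued_set (e f)"
proof -
  have "sat_H \<theta> \<Delta> (fm_single_valued f s) e \<longleftrightarrow> (\<forall>x\<in>H \<theta>. \<forall>y\<in>H \<theta>. \<forall>y'\<in>H \<theta>.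
      opair x y \<in> elts (e f) \<longrightarrow> opair x y' \<in> elts (e f) \<longrightarrow> y = y')"
    using assms by (simp add: fm_single_valued_def sat_fm_opair_mem)
  moreover have "opair x y \<in> elts (e f) \<Longrightarrow> x \<in> H \<theta> \<and> y \<in> H \<theta>" for x y
    using H_opairD H_trans assms(3) by blast
  ultimately show ?thesis
    unfolding single_valued_set_def by blast
qed

lemma sat_fm_regressive:
  assumes "regular \<theta>" "o2 < s" "f < s" "e o2 = omega2" "omega2 \<in> H \<theta>" "e f \<in> H \<theta>"
  shows "sat_H \<theta> \<Delta> (fm_regressive o2 f s) e \<longleftrightarrow> regressive_function (e f)"
proof -
  have "sat_H \<theta> \<Delta> (fm_regressive o2 f s) e \<longleftrightarrow> single_valued_set (e f) \<and>
      (\<forall>u\<in>H \<theta>. u \<in> elts (e f) \<longrightarrow> (\<exists>\<beta>\<in>H \<theta>. \<beta> \<in> elts omega2 \<and>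
        (\<exists>\<xi>\<in>H \<theta>. \<xi> \<in> elts \<beta> \<and> u = opair \<beta> \<xi>)))"
    using assms by (simp add: fm_regressive_def sat_fm_single_valued sat_fm_opair)
  moreover have "u \<in> elts (e f) \<Longrightarrow> u \<in> H \<theta>" "\<beta> \<in> elts omega2 \<Longrightarrow> \<beta> \<in> H \<theta>"
    "\<beta> \<in> elts omega2 \<Longrightarrow> \<xi> \<in> elts \<beta> \<Longrightarrow> \<xi> \<in> H \<theta>" for u \<beta> \<xi>
    using H_trans assms(5,6) by blast+
  ultimately show ?thesis
    unfolding regressive_function_def by blast
qed

lemma sat_fm_good_for:
  assumes "regular \<theta>" "o2 < s" "m < s" "e o2 = omega2" "omega2 \<in> H \<theta>" "e m \<in> H \<theta>"
  shows "sat_H \<theta> \<Delta> (fm_good_for o2 m s) e \<longleftrightarrow> good_for (elts (e m))"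
proof -
  have "sat_H \<theta> \<Delta> (fm_good_for o2 m s) e \<longleftrightarrow> (\<forall>\<beta>\<in>H \<theta>. \<beta> \<in> elts omega2 \<longrightarrow>
      (\<exists>\<alpha>\<in>H \<theta>. \<alpha> \<in> elts omega2 \<and> \<beta> \<in> elts \<alpha> \<and> (\<forall>f\<in>H \<theta>. f \<in> elts (e m) \<longrightarrow>
        regressive_function f \<longrightarrow> (\<forall>\<xi>\<in>H \<theta>. opair \<alpha> \<xi> \<in> elts f \<longrightarrow> \<xi> \<in> elts (e m)))))"
    using assms by (simp add: fm_good_for_def sat_fm_regressive sat_fm_opair_mem)
  moreover have "f \<in> elts (e m) \<Longrightarrow> f \<in> H \<theta>" "\<beta> \<in> elts omega2 \<Longrightarrow> \<beta> \<in> H \<theta>"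
    "f \<in> elts (e m) \<Longrightarrow> opair \<alpha> \<xi> \<in> elts f \<Longrightarrow> \<xi> \<in> H \<theta>" for f \<beta> \<alpha> \<xi>
    using H_trans H_opairD assms(5,6) by blast+
  ultimately show ?thesis
    unfolding good_for_def by meson
qed

lemma sat_fm_opair_closed:
  assumes "regular \<theta>" "m < s" "e m \<in> H \<theta>"
  shows "sat_H \<theta> \<Delta> (fm_opair_closed m s) e \<longleftrightarrow> opair_closed (elts (e m))"
  using assms H_trans[OF assms(3)] by (auto simp: fm_opair_closed_def opair_closed_def sat_fm_opair_mem)

lemma sat_fm_closed_under:
  assumes "regular \<theta>" "c < s" "m < s" "e c \<in> H \<theta>" "e m \<in> H \<theta>"
  shows "sat_H \<theta> \<Delta> (fm_closed_under c m s) e \<longleftrightarrow> closed_under (e c) (elts (e m))"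
proof -
  have "sat_H \<theta> \<Delta> (fm_closed_under c m s) e \<longleftrightarrow> (\<forall>x\<in>H \<theta>. x \<in> elts (e m) \<longrightarrow>
      (\<forall>y\<in>H \<theta>. opair x y \<in> elts (e c) \<longrightarrow> y \<in> elts (e m)))"
    using assms by (simp add: fm_closed_under_def sat_fm_opair_mem)
  moreover have "opair x y \<in> elts (e c) \<Longrightarrow> x \<in> H \<theta> \<and> y \<in> H \<theta>" for x y
    using H_opairD H_trans assms(4) by blast
  ultimately show ?thesis
    unfolding closed_under_def by blast
qed

text \<open>\<open>H \<theta>\<close> sees only the M included in it, so the formula expresses a
  restricted form of \<open>guides\<close>. It sees all of those, since a countable subset of
  \<open>H \<theta>\<close> has size below \<theta>.\<close>

lemma sat_fm_guides:
  assumes \<theta>: "regular \<theta>" "omega2 \<in> elts \<theta>" and less: "o2 < s" "o0 < s" "c < s"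
    and e: "e o2 = omega2" "e o0 = omega0" "e c \<in> H \<theta>"
  shows "sat_H \<theta> \<Delta> (fm_guides o2 o0 c s) e \<longleftrightarrow> single_valued_set (e c) \<and>
    (\<forall>M. M \<subseteq> H \<theta> \<and> countable M \<and> omega0 \<in> M \<and> opair_closed M \<and> closed_under (e c) M \<longrightarrow>
      good_for M)"
proof -
  have o2: "omega2 \<in> H \<theta>"
    using H_Ord \<theta> by blast
  then have o0: "omega0 \<in> H \<theta>"
    using H_trans omega_facts(5) by blast
  have "sat_H \<theta> \<Delta> (fm_guides o2 o0 c s) e \<longleftrightarrow> single_valued_set (e c) \<and>
      (\<forall>m\<in>H \<theta>. countable (elts m) \<longrightarrow> omega0 \<in> elts m \<longrightarrow> opair_closed (elts m) \<longrightarrow>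
        closed_under (e c) (elts m) \<longrightarrow> good_for (elts m))"
    using assms o2 o0
    by (simp add: fm_guides_def sat_fm_single_valued sat_fm_lepoll sat_fm_opair_closed
        sat_fm_closed_under sat_fm_good_for countable_lepoll_omega0[where 'v = 'a])
      blast
  moreover have "\<exists>m\<in>H \<theta>. elts m = M" if "M \<subseteq> H \<theta>" "countable M" for M
  proof -
    have "M \<lesssim> elts (omega0 :: 'a)"
      using that(2) countable_lepoll_omega0 by blast
    then have "M \<prec> elts \<theta>"
      using H_elts_lesspoll[OF o0] lesspoll_trans1 by blast
    then show ?thesis
      using H_vset[OF \<theta>(1) that(1)] by (intro bexI[of _ "vset M"]) auto
  qed
  moreover have "m \<in> H \<theta> \<Longrightarrow> elts m \<subseteq> H \<theta>" for m
    using H_trans by blast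
  ultimately show ?thesis
    by metis
qed

section \<open>The gap extension of an arbitrary countable N\<close>

lemma elem_sub_good_for:
  fixes N :: "'v::zfc set"
  assumes \<theta>: "regular \<theta>" "omega2 \<in> elts \<theta>" and c: "guides c" "c \<in> H \<theta>"
    and N: "elem_sub (mem_ord_interp \<Delta>) N (H \<theta>)" "countable N"
  shows "good_for N"
proof -
  have NH: "N \<subseteq> H \<theta>"
    using N unfolding elem_sub_def by blast
  note o = omega_mem_elem_sub[OF \<theta> N(1)]
  define e :: "nat \<Rightarrow> 'v" where "e = (\<lambda>_. omega2)(1 := omega0)"
  have e: "range e \<subseteq> N"
    using o by (auto simp: e_def)
  have sat_c: "sat_H \<theta> \<Delta> (fm_guides 0 1 2 3) (e(2 := c)) \<longleftrightarrow> single_valued_set c \<and>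
      (\<forall>M. M \<subseteq> H \<theta> \<and> countable M \<and> omega0 \<in> M \<and> opair_closed M \<and> closed_under c M \<longrightarrow>
        good_for M)" if "c \<in> H \<theta>" for c
    using sat_fm_guides[OF \<theta>, of 0 3 1 2 "e(2 := c)"] that by (simp add: e_def)
  have "sat_H \<theta> \<Delta> (fm_guides 0 1 2 3) (e(2 := c))"
    unfolding sat_c[OF c(2)] using c(1) unfolding guides_def by blast
  then obtain d where d: "d \<in> N" "sat_H \<theta> \<Delta> (fm_guides 0 1 2 3) (e(2 := d))"
    using elem_sub_witness[OF N(1) e c(2)] by blast
  have dH: "d \<in> H \<theta>"
    using d(1) NH by blast
  have sv: "single_valued_set d"
    and good: "\<And>M. M \<subseteq> H \<theta> \<Longrightarrow> countable M \<Longrightarrow> omega0 \<in> M \<Longrightarrow> opair_closed M \<Longrightarrow>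
      closed_under d M \<Longrightarrow> good_for M"
    using d(2) unfolding sat_c[OF dH] by blast+
  have "opair_closed N"
    unfolding opair_closed_def
  proof (intro ballI)
    fix x y assume xy: "x \<in> N" "y \<in> N"
    define h where "h = (\<lambda>_::nat. x)(1 := y)"
    have h: "range h \<subseteq> N"
      using xy by (auto simp: h_def)
    have sat_h: "sat_H \<theta> \<Delta> (fm_opair 2 0 1 3) (h(2 := u)) \<longleftrightarrow> u = opair x y" if "u \<in> H \<theta>" for u
      using sat_fm_opair[OF \<theta>(1), of 2 3 0 1 "h(2 := u)"] that xy NH by (auto simp: h_def)
    have "opair x y \<in> H \<theta>"
      using H_opair[OF \<theta>(1)] xy NH by blast
    then obtain u where "u \<in> N" "sat_H \<theta> \<Delta> (fm_opair 2 0 1 3) (h(2 := u))"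
      using elem_sub_witness[OF N(1) h, of "opair x y" "fm_opair 2 0 1 3" 2] sat_h by blast
    then show "opair x y \<in> N"
      using sat_h NH by blast
  qed
  moreover have "closed_under d N"
    unfolding closed_under_def
  proof (intro ballI allI impI)
    fix x y assume x: "x \<in> N" and y: "opair x y \<in> elts d"
    define h where "h = (\<lambda>_::nat. x)(1 := d)"
    have h: "range h \<subseteq> N"
      using x d(1) by (auto simp: h_def)
    have sat_h: "sat_H \<theta> \<Delta> (fm_opair_mem 1 0 2 3) (h(2 := u)) \<longleftrightarrow> opair x u \<in> elts d"
      if "u \<in> H \<theta>" for u
      using sat_fm_opair_mem[OF \<theta>(1), of 1 3 0 2 "h(2 := u)"] that x dH NH by (auto simp: h_def)
    have "y \<in> H \<theta>"
      using H_opairD H_trans dH y by blast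
    then obtain u where "u \<in> N" "sat_H \<theta> \<Delta> (fm_opair_mem 1 0 2 3) (h(2 := u))"
      using elem_sub_witness[OF N(1) h, of y "fm_opair_mem 1 0 2 3" 2] sat_h y by blast
    \<comment> \<open>Elementarity only gives some value u in N. That u is y follows from
      single-valuedness, which is why \<open>guides\<close> includes it.\<close>
    then have "opair x u \<in> elts d"
      using sat_h NH by blast
    then show "y \<in> N"
      using sv y \<open>u \<in> N\<close> unfolding single_valued_set_def by blast
  qed
  ultimately show ?thesis
    using good NH N(2) o(1) by blast
qed

lemma function_values_below:
  fixes N :: "'v::zfc set"
  assumes \<theta>: "regular \<theta>" "omega2 \<in> elts \<theta>" and N: "elem_sub (mem_ord_interp \<Delta>) N (H \<theta>)"
    and \<alpha>: "\<alpha> \<in> elts omega2"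
    and good: "\<And>f \<xi>. f \<in> N \<Longrightarrow> regressive_function f \<Longrightarrow> opair \<alpha> \<xi> \<in> elts f \<Longrightarrow> \<xi> \<in> N"
  shows "function_values N \<alpha> \<inter> elts \<alpha> \<subseteq> N"
proof
  fix x assume x: "x \<in> function_values N \<alpha> \<inter> elts \<alpha>"
  then obtain f where f: "f \<in> N" "single_valued_set f" "opair \<alpha> x \<in> elts f"
    unfolding function_values_def by blast
  have NH: "N \<subseteq> H \<theta>"
    using N unfolding elem_sub_def by blast
  note o = omega_mem_elem_sub[OF \<theta> N]
  \<comment> \<open>Defines the part of f below the diagonal on omega_2.\<close>
  let ?\<phi> = "Conj (FMem 1 0) (fm_opair_mem 2 0 1 3)"
  have H: "\<beta> \<in> elts omega2 \<Longrightarrow> \<beta> \<in> H \<theta>" for \<beta>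
    using o NH H_trans by blast
  have sat_\<phi>: "sat_H \<theta> \<Delta> ?\<phi> ((\<lambda>_. f)(0 := \<beta>, 1 := y)) \<longleftrightarrow> y \<in> elts \<beta> \<and> opair \<beta> y \<in> elts f"
    if "\<beta> \<in> elts omega2" "y \<in> H \<theta>" for \<beta> y
    using sat_fm_opair_mem[OF \<theta>(1), of 2 3 0 1 "(\<lambda>_. f)(0 := \<beta>, 1 := y)"] that H f(1) NH by auto
  have ex: "\<exists>g\<in>N. elts g = {opair \<beta> y |\<beta> y. \<beta> \<in> elts omega2 \<and> y \<in> H \<theta> \<and>
      sat_H \<theta> \<Delta> ?\<phi> ((\<lambda>_. f)(0 := \<beta>, 1 := y))}"
  proof (rule definable_function_mem[OF \<theta>(1) N o(2)])
    fix \<beta> y y' assume "\<beta> \<in> elts omega2" "y \<in> H \<theta>" "y' \<in> H \<theta>"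
      "sat_H \<theta> \<Delta> ?\<phi> ((\<lambda>_. f)(0 := \<beta>, 1 := y))" "sat_H \<theta> \<Delta> ?\<phi> ((\<lambda>_. f)(0 := \<beta>, 1 := y'))"
    then show "y = y'"
      using sat_\<phi> f(2) unfolding single_valued_set_def by blast
  qed (use f(1) in auto)
  obtain g where g: "g \<in> N"
    "elts g = {opair \<beta> y |\<beta> y. \<beta> \<in> elts omega2 \<and> y \<in> H \<theta> \<and> y \<in> elts \<beta> \<and> opair \<beta> y \<in> elts f}"
  proof -
    have "{opair \<beta> y |\<beta> y. \<beta> \<in> elts omega2 \<and> y \<in> H \<theta> \<and>
        sat_H \<theta> \<Delta> ?\<phi> ((\<lambda>_. f)(0 := \<beta>, 1 := y))} =
      {opair \<beta> y |\<beta> y. \<beta> \<in> elts omega2 \<and> y \<in> H \<theta> \<and> y \<in> elts \<beta> \<and> opair \<beta> y \<in> elts f}"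
      by (intro Collect_cong ex_cong1 conj_cong refl) (rule sat_\<phi>; assumption)
    with that ex show ?thesis
      by auto
  qed
  have "regressive_function g"
    unfolding regressive_function_def single_valued_set_def g(2)
    using f(2) unfolding single_valued_set_def by auto
  moreover have "opair \<alpha> x \<in> elts g"
    unfolding g(2) using x f(3) \<alpha> H[OF \<alpha>] H_trans by blast
  ultimately show "x \<in> N"
    using good g(1) by blast
qed

text \<open>That omega_2 is a limit reflects to N. It makes every element of N \<inter> omega_2
  strictly smaller than the supremum.\<close>

lemma elem_sub_omega2_no_max:
  fixes N :: "'v::zfc set"
  assumes \<theta>: "regular \<theta>" "omega2 \<in> elts \<theta>" and N: "elem_sub (mem_ord_interp \<Delta>) N (H \<theta>)"
    and x: "x \<in> N" "x \<in> elts omega2"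
  shows "\<exists>y\<in>N \<inter> elts omega2. x \<in> elts y"
proof -
  note o = omega_mem_elem_sub[OF \<theta> N]
  have "infinite (elts (omega1 :: 'v))"
    using omega_facts(1,3) Ord_trans omega0_spec(2) finite_subset by blast
  then obtain y where y: "y \<in> elts omega2" "x \<in> elts y"
    using card_succ_limit[of omega1 x] x(2) unfolding omega2_def by blast
  define h where "h = (\<lambda>_::nat. x)(1 := omega2)"
  have h: "range h \<subseteq> N"
    using x(1) o by (auto simp: h_def)
  have "y \<in> H \<theta>"
    using y(1) H_trans H_Ord[OF \<theta>] by blast
  then obtain z where "z \<in> N" "sat_H \<theta> \<Delta> (Conj (FMem 2 1) (FMem 0 2)) (h(2 := z))"
    using elem_sub_witness[OF N h, of y "Conj (FMem 2 1) (FMem 0 2)" 2] y by (auto simp: h_def)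
  then show ?thesis
    by (auto simp: h_def)
qed

lemma gap_extension:
  fixes N :: "'v::zfc set"
  assumes \<theta>: "regular \<theta>" "omega2 \<in> elts \<theta>" and c: "guides c" "c \<in> H \<theta>"
    and wo: "well_order_on (H \<theta>) \<Delta>" and N: "countable N" "elem_sub_H_ord N \<theta> \<Delta>"
    and \<beta>: "\<beta> \<in> elts omega2"
  shows "\<exists>\<alpha>\<in>elts omega2. elts \<beta> \<subseteq> elts \<alpha> \<and> (\<exists>N'. elem_sub_H_ord N' \<theta> \<Delta> \<and> N \<sqsubseteq> N' \<and>
    N' \<inter> ord_interval \<alpha> omega2 \<noteq> {} \<and>
    N' \<inter> ord_interval (ord_sup (N \<inter> elts omega2)) \<alpha> = {})"
proof -
  have NE: "elem_sub (mem_ord_interp \<Delta>) N (H \<theta>)"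
    using N(2) unfolding elem_sub_H_ord_def mem_ord_interp_def .
  have O: "Ord \<xi>" if "\<xi> \<in> elts omega2" for \<xi> :: 'v
    using that Ord_mem omega_facts(2) by blast
  \<comment> \<open>The larger of \<beta> and omega_1: the former for cofinality, the latter so that
    \<alpha> lies above omega_1 and no new countable ordinal enters N'.\<close>
  define \<gamma> where "\<gamma> = (if \<beta> \<in> elts omega1 then omega1 else \<beta>)"
  have \<gamma>: "\<gamma> \<in> elts omega2" "elts \<beta> \<subseteq> elts \<gamma>" "elts omega1 \<subseteq> elts \<gamma>"
    using \<beta> omega_facts Ord_linear[OF omega_facts(1) O[OF \<beta>]] Ord_trans[OF O[OF \<beta>]]
      Ord_trans[OF omega_facts(1), of \<beta>] by (auto simp: \<gamma>_def)
  obtain \<alpha> where \<alpha>: "\<alpha> \<in> elts omega2" "\<gamma> \<in> elts \<alpha>"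
    and good: "\<And>f \<xi>. f \<in> N \<Longrightarrow> regressive_function f \<Longrightarrow> opair \<alpha> \<xi> \<in> elts f \<Longrightarrow> \<xi> \<in> N"
    using elem_sub_good_for[OF \<theta> c NE N(1)] \<gamma>(1) unfolding good_for_def by blast
  have \<gamma>\<alpha>: "elts \<gamma> \<subseteq> elts \<alpha>"
    using Ord_trans[OF O[OF \<alpha>(1)] \<alpha>(2)] .
  let ?N' = "function_values N \<alpha>"
  note N' = function_values_elem_sub[OF \<theta>(1) wo NE omega_mem_elem_sub(2)[OF \<theta> NE] \<alpha>(1)]
  have below: "?N' \<inter> elts \<alpha> \<subseteq> N"
    by (rule function_values_below[OF \<theta> NE \<alpha>(1) good])
  have "elem_sub_H_ord ?N' \<theta> \<Delta>"
    using N'(3) unfolding elem_sub_H_ord_def mem_ord_interp_def .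
  moreover have "N \<sqsubseteq> ?N'"
    unfolding end_sub_def using N'(1) below \<gamma>(3) \<gamma>\<alpha> by blast
  moreover have "\<alpha> \<in> ?N' \<inter> ord_interval \<alpha> omega2"
    using N'(2) \<alpha>(1) by (simp add: ord_interval_def)
  \<comment> \<open>An element of N' below \<alpha> already lies in N, hence strictly below the left
    end of the interval.\<close>
  moreover have "x \<notin> ord_interval (ord_sup (N \<inter> elts omega2)) \<alpha>" if "x \<in> ?N'" for x
  proof
    assume "x \<in> ord_interval (ord_sup (N \<inter> elts omega2)) \<alpha>"
    then have x: "x \<in> elts \<alpha>" "elts (ord_sup (N \<inter> elts omega2)) \<subseteq> elts x"
      by (auto simp: ord_interval_def)
    have "x \<in> N" "x \<in> elts omega2"
      using below that x(1) Ord_trans[OF omega_facts(2) \<alpha>(1)] by blast+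
    then obtain y where y: "y \<in> N \<inter> elts omega2" "x \<in> elts y"
      using elem_sub_omega2_no_max[OF \<theta> NE] by blast
    have "small (\<Union>\<xi>\<in>N \<inter> elts omega2. elts \<xi>)"
      using small_Union[OF countable_small] N(1) by (metis countable_Int1 small_elts)
    then have "x \<in> elts (ord_sup (N \<inter> elts omega2))"
      using y by (auto simp: ord_sup_def)
    then show False
      using x(2) mem_not_refl by blast
  qed
  ultimately show ?thesis
    using \<alpha>(1) \<gamma>(2) \<gamma>\<alpha> by blast
qed

theorem theorem6:
  assumes "\<exists>J :: 'v::zfc set set. normal_ideal_on omega2 J \<and>
    proper_forcing (quot_carrier omega2 J) (quot_le omega2 J)"
  shows "SCC_cof_gap TYPE('v)"
proof -
  obtain J :: "'v set set" where J: "normal_ideal_on omega2 J"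
    and proper: "proper_forcing (quot_carrier omega2 J) (quot_le omega2 J)"
    using assms by blast
  let ?P = "quot_carrier omega2 J" and ?R = "quot_le omega2 J"
  obtain p0 where p0: "p0 \<in> ?P"
    using proper unfolding proper_forcing_def forcing_def by blast
  obtain T :: 'v where T: "\<And>f. regressive_function f \<Longrightarrow> elts f \<subseteq> elts T"
    using regressive_functions_bounded by blast
  define Q where "Q \<chi> \<longleftrightarrow> (\<forall>M. countable M \<and> elem_sub_H M \<chi> \<and> forcing_code ?P ?R \<in> M \<longrightarrow>
      (\<forall>p \<in> ?P \<inter> M. \<exists>q. (q, p) \<in> ?R \<and> generic_condition ?P ?R M q))" for \<chi>
  have "for_large_regular Q"
    using proper unfolding proper_forcing_def Q_def by (rule conjunct2)
  then have "for_large_regular (\<lambda>\<chi>. Q \<chi> \<and>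
      omega2 \<in> H \<chi> \<and> vset ?P \<in> H \<chi> \<and> forcing_code ?P ?R \<in> H \<chi> \<and> T \<in> H \<chi>)"
    by (intro for_large_regular_conj for_large_regular_H)
  then consider \<comment> \<open>Without a regular cardinal beyond the threshold, the gap principle holds vacuously.\<close>
    "for_large_regular (\<lambda>\<theta> :: 'v. False)" | \<chi> where "regular \<chi>" "Q \<chi>"
    "omega2 \<in> H \<chi>" "vset ?P \<in> H \<chi>" "forcing_code ?P ?R \<in> H \<chi>" "T \<in> H \<chi>"
    using for_large_regular_witness[where Q = "\<lambda>\<theta> :: 'v. False"] by blast
  then show ?thesis
  proof cases
    case 1
    then show ?thesis
      unfolding SCC_cof_gap_def by (rule for_large_regular_mono) blast
  next
    case (2 \<chi>)
    have "\<exists>c :: 'v. guides c"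
    proof (rule guides_exists[OF J 2(1,3-6) T p0])
      fix M p assume "countable M" "elem_sub_H M \<chi>" "forcing_code ?P ?R \<in> M" "p \<in> ?P \<inter> M"
      then have "\<exists>q. (q, p) \<in> ?R \<and> generic_condition ?P ?R M q"
        using 2(2) unfolding Q_def by simp
      then show "\<exists>q. generic_condition ?P ?R M q"
        by blast
    qed
    then obtain c :: 'v where c: "guides c"
      by blast
    \<comment> \<open>The guide is fixed before \<theta>, \<Delta> and N, so one threshold serves
      them all.\<close>
    have "for_large_regular (\<lambda>\<theta>. omega2 \<in> elts \<theta> \<and> c \<in> H \<theta>)"
      by (intro for_large_regular_conj for_large_regular_H for_large_regular_mem omega_facts)
    then show ?thesis
      unfolding SCC_cof_gap_def
    proof (rule for_large_regular_mono, intro allI impI ballI)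
      fix \<theta> \<Delta> N and \<beta> :: 'v
      assume "regular \<theta>" "omega2 \<in> elts \<theta> \<and> c \<in> H \<theta>" "\<beta> \<in> elts omega2"
        and "well_order_on (H \<theta>) \<Delta> \<and> countable N \<and> elem_sub_H_ord N \<theta> \<Delta>"
      then show "\<exists>\<alpha>\<in>elts omega2. elts \<beta> \<subseteq> elts \<alpha> \<and> (\<exists>N'. elem_sub_H_ord N' \<theta> \<Delta> \<and>
          N \<sqsubseteq> N' \<and> N' \<inter> ord_interval \<alpha> omega2 \<noteq> {} \<and>
          N' \<inter> ord_interval (ord_sup (N \<inter> elts omega2)) \<alpha> = {})"
        by (intro gap_extension[OF _ _ c]) simp_all
    qed
  qed
qed

end
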